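(* Let $H$ be a real inner product space (not necessarily complete) with $\dim H\geq 3$ (possibly infinite), and let $0<\alpha<\pi$. Assume that $\psi\colon S_H\to S_H$ is a bijective map satisfying $$\sphericalangle(x,y)=\alpha \iff \sphericalangle(\psi(x),\psi(y))=\alpha \quad (x,y\in S_H).$$ Then there exists a bijective linear isometry $R\colon H\to H$ such that (i) if $\alpha\neq\tfrac{\pi}{2}$, then $\psi(x)=Rx$ for every $x\in S_H$; (ii) if $\alpha=\tfrac{\pi}{2}$, then $\psi(x)\in\{-Rx,Rx\}$ for every $x\in S_H$.
   Context: $S_H=\{h\in H\colon \|h\|=1\}$ is the unit sphere of $H$. For $x,y\in S_H$ the angle is $\sphericalangle(x,y)=\arccos\langle x,y\rangle\in[0,\pi]$. *)

theory Defs
  imports "HOL-Analysis.Analysis"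
begin

text \<open>
  The library constant \<open>dim\<close> is \<open>0\<close> on infinite-dimensional spaces, so a lower bound on the
  dimension is stated through a Hamel basis. All Hamel bases have the same cardinality, so it does
  not matter which one is taken.
\<close>

definition dim_at_least :: "nat \<Rightarrow> 'a::real_vector itself \<Rightarrow> bool" where
  "dim_at_least n (_ :: 'a itself) \<longleftrightarrow>
     (\<exists>B :: 'a set. independent B \<and> span B = UNIV \<and> (finite B \<longrightarrow> n \<le> card B))"

text \<open>
  Intended for unit vectors only, where the inner product lies in \<open>{-1..1}\<close>; outside that range
  \<open>arccos\<close> is unspecified.
\<close>

definition sphere_angle :: "'a::real_inner \<Rightarrow> 'a \<Rightarrow> real" where
  "sphere_angle x y = arccos (x \<bullet> y)"

definition bij_linear_isometry :: "('a::real_normed_vector \<Rightarrow> 'a) \<Rightarrow> bool" where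
  "bij_linear_isometry R \<longleftrightarrow> linear R \<and> bij R \<and> (\<forall>x. norm (R x) = norm x)"

end

theory Submission
  imports Defs
begin

text \<open>
  Put \<open>c = cos \<alpha>\<close>; then \<open>\<psi>\<close> preserves the relation \<open>x \<bullet> y = c\<close>, hence every relation on the sphere
  that is definable from it.

  If \<open>c = 0\<close>, take orthonormal vectors and let \<open>(1, f s, g t)\<close> be the direction of the image of
  \<open>(1, s, t)\<close> in the corresponding coordinates. Preservation of orthogonality turns \<open>f\<close> and \<open>g\<close>, up
  to sign, into one field automorphism of the reals, that is, into the identity. Hence
  \<open>\<bar>\<psi> x \<bullet> \<psi> y\<bar> = \<bar>x \<bullet> y\<bar>\<close>, and the signs are corrected as in Wigner's theorem.

  If \<open>c \<noteq> 0\<close>, call \<open>r\<close> a preserved radius if \<open>\<psi>\<close> preserves both \<open>angle \<le> r\<close> and \<open>angle < r\<close>. Having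
  one, respectively two, common neighbours shows that \<open>arccos (2 * c\<^sup>2 - 1)\<close> is one. Preserved radii
  are closed under sums below \<open>pi\<close> and under differences, and with every preserved radius \<open>r < pi / 2\<close>
  the long diagonal of the spherical rhombus with side and short diagonal \<open>r\<close> is one that
  lies strictly between \<open>r\<close> and \<open>2 * r\<close>. So the infimum of the preserved radii is \<open>0\<close>, they are dense
  in the interval from \<open>0\<close> to \<open>pi\<close>, and \<open>\<psi>\<close> preserves all angles. If all the radii obtained at first
  exceed \<open>pi / 2\<close>, differences produce a smaller one, except for \<open>2 * pi / 3\<close> (where \<open>2 * pi - 2 * r = r\<close>);
  there an ad hoc configuration yields the additional preserved radius \<open>arccos (- 1/3)\<close>.
\<close>

section \<open>Angles on the unit sphere\<close>

lemma norm_1_iff: "norm (x::'a::real_inner) = 1 \<longleftrightarrow> x \<bullet> x = 1"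
  by (simp add: norm_eq_sqrt_inner)

lemma inner_bounds:
  fixes x y :: "'a::real_inner"
  assumes "norm x = 1" "norm y = 1"
  shows "x \<bullet> y \<le> 1" "- 1 \<le> x \<bullet> y"
  using Cauchy_Schwarz_ineq2[of x y] assms by auto

section \<open>Orthonormal frames in dimension at least three\<close>

text \<open>By Steinitz exchange, an independent set inside \<open>span {e1, e2}\<close> has at most
  two elements, so some \<open>v\<close> lies outside; one Gram-Schmidt step makes it orthogonal to
  both vectors. Allowing \<open>e2 = 0\<close> also covers a single vector.\<close>

lemma exists_unit_orthogonal2:
  fixes e1 e2 :: "'a::real_inner"
  assumes dim: "dim_at_least 3 TYPE('a)"
    and "norm e1 = 1" "norm e2 = 1 \<or> e2 = 0" "e1 \<bullet> e2 = 0"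
  shows "\<exists>w. norm w = 1 \<and> w \<bullet> e1 = 0 \<and> w \<bullet> e2 = 0"
proof -
  obtain B :: "'a set" where B: "independent B" "finite B \<longrightarrow> 3 \<le> card B"
    using dim unfolding dim_at_least_def by blast
  have "span {e1, e2} \<noteq> UNIV"
  proof
    assume "span {e1, e2} = UNIV"
    then have "finite B \<and> card B \<le> card {e1, e2}"
      using independent_span_bound[of "{e1, e2}" B] B(1) by auto
    moreover have "card {e1, e2} \<le> 2"
      by (simp add: card_insert_if)
    ultimately show False using B(2) by linarith
  qed
  then obtain v where v: "v \<notin> span {e1, e2}" by blast
  define w where "w = v - (v \<bullet> e1) *\<^sub>R e1 - (v \<bullet> e2) *\<^sub>R e2"
  have "w \<noteq> 0"
  proof
    assume "w = 0"
    then have "v = (v \<bullet> e1) *\<^sub>R e1 + (v \<bullet> e2) *\<^sub>R e2" by (simp add: w_def algebra_simps)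
    also have "\<dots> \<in> span {e1, e2}"
      by (intro span_add span_scale span_base) auto
    finally show False using v by simp
  qed
  moreover have "w \<bullet> e1 = 0" "w \<bullet> e2 = 0"
    using assms(2-4) inner_commute[of e2 e1] by (auto simp: w_def norm_1_iff inner_diff_left)
  ultimately have "norm (sgn w) = 1 \<and> sgn w \<bullet> e1 = 0 \<and> sgn w \<bullet> e2 = 0"
    by (simp add: norm_sgn sgn_div_norm)
  then show ?thesis by blast
qed

text \<open>Gram-Schmidt applied to \<open>x\<close> and \<open>y\<close>, completed by a spare
  direction \<open>f\<close>. If \<open>y\<close> is a multiple of \<open>x\<close>, any unit
  \<open>e\<close> orthogonal to \<open>x\<close> serves.\<close>

lemma exists_frame:
  fixes x y :: "'a::real_inner"
  assumes dim: "dim_at_least 3 TYPE('a)" and x: "norm x = 1"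
  shows "\<exists>e f k. norm e = 1 \<and> norm f = 1 \<and> x \<bullet> e = 0 \<and> x \<bullet> f = 0 \<and> e \<bullet> f = 0
           \<and> 0 \<le> k \<and> y = (x \<bullet> y) *\<^sub>R x + k *\<^sub>R e"
proof -
  define v where "v = y - (x \<bullet> y) *\<^sub>R x"
  have vx: "x \<bullet> v = 0" using x by (simp add: v_def inner_diff_right norm_1_iff)
  have "\<exists>e. norm e = 1 \<and> x \<bullet> e = 0 \<and> v = norm v *\<^sub>R e"
  proof (cases "v = 0")
    case True
    then show ?thesis using exists_unit_orthogonal2[OF dim x, of 0] by (auto simp: inner_commute)
  next
    case False
    then show ?thesis using vx by (intro exI[of _ "sgn v"]) (auto simp: norm_sgn sgn_div_norm)
  qed
  then obtain e where e: "norm e = 1" "x \<bullet> e = 0" "v = norm v *\<^sub>R e" by blast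
  obtain f where "norm f = 1" "f \<bullet> x = 0" "f \<bullet> e = 0"
    using exists_unit_orthogonal2[OF dim x, of e] e by auto
  moreover have "y = (x \<bullet> y) *\<^sub>R x + norm v *\<^sub>R e" using e(3) by (simp add: v_def)
  ultimately show ?thesis using e by (metis inner_commute norm_ge_zero)
qed

lemma exists_unit_orthogonal:
  fixes x y :: "'a::real_inner"
  assumes dim: "dim_at_least 3 TYPE('a)" and x: "norm x = 1"
  obtains w where "norm w = 1" "w \<bullet> x = 0" "w \<bullet> y = 0"
proof -
  obtain e f k where *: "norm f = 1" "x \<bullet> f = 0" "e \<bullet> f = 0" "y = (x \<bullet> y) *\<^sub>R x + k *\<^sub>R e"
    using exists_frame[OF dim x, of y] by blast
  have "f \<bullet> y = f \<bullet> ((x \<bullet> y) *\<^sub>R x + k *\<^sub>R e)" by (rule arg_cong[of y _ "\<lambda>u. f \<bullet> u", OF *(4)])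
  also have "\<dots> = 0" using *(2,3) by (simp add: inner_add_right inner_commute)
  finally have "f \<bullet> y = 0" .
  then show ?thesis using * that[of f] by (simp add: inner_commute)
qed

section \<open>The sphere as a geodesic metric space\<close>

lemma sphere_angle_bounds:
  assumes "norm x = 1" "norm y = 1"
  shows "0 \<le> sphere_angle x y" "sphere_angle x y \<le> pi"
  using inner_bounds[OF assms] by (auto simp: sphere_angle_def intro: arccos_lbound arccos_ubound)

lemma cos_sphere_angle:
  assumes "norm x = 1" "norm y = 1"
  shows "cos (sphere_angle x y) = x \<bullet> y"
  using inner_bounds[OF assms] by (simp add: sphere_angle_def)

lemma sphere_angle_minus [simp]:
  assumes "norm x = 1" "norm y = 1"
  shows "sphere_angle x (- y) = pi - sphere_angle x y"
    and "sphere_angle (- x) y = pi - sphere_angle x y"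
  using inner_bounds[OF assms] by (auto simp: sphere_angle_def arccos_minus)

lemma sphere_angle_le_iff:
  assumes "norm x = 1" "norm y = 1" "0 \<le> r" "r \<le> pi"
  shows "sphere_angle x y \<le> r \<longleftrightarrow> cos r \<le> x \<bullet> y"
  using cos_mono_le_eq[of r "sphere_angle x y"] sphere_angle_bounds[OF assms(1,2)] assms
  by (simp add: cos_sphere_angle)

lemma sphere_angle_less_iff:
  assumes "norm x = 1" "norm y = 1" "0 \<le> r" "r \<le> pi"
  shows "sphere_angle x y < r \<longleftrightarrow> cos r < x \<bullet> y"
  using cos_mono_less_eq[of r "sphere_angle x y"] sphere_angle_bounds[OF assms(1,2)] assms
  by (simp add: cos_sphere_angle)

text \<open>Cauchy-Schwarz for the components \<open>u\<close>, \<open>v\<close> of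
  \<open>x\<close>, \<open>y\<close> orthogonal to \<open>z\<close>: their norms are the sines of
  the two angles, so \<open>x \<bullet> y\<close> is at least the cosine of the sum. A sum above
  \<open>pi\<close> is trivial.\<close>

lemma sphere_angle_triangle:
  assumes x: "norm x = 1" and y: "norm y = 1" and z: "norm z = 1"
  shows "sphere_angle x y \<le> sphere_angle x z + sphere_angle z y"
proof (cases "sphere_angle x z + sphere_angle z y \<le> pi")
  case True
  define a b where "a = sphere_angle x z" and "b = sphere_angle z y"
  have ab: "0 \<le> a" "a \<le> pi" "0 \<le> b" "b \<le> pi" "cos a = x \<bullet> z" "cos b = z \<bullet> y"
    using sphere_angle_bounds cos_sphere_angle assms by (auto simp: a_def b_def)
  define u v where "u = x - (x \<bullet> z) *\<^sub>R z" and "v = y - (z \<bullet> y) *\<^sub>R z"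
  have "u \<bullet> u = 1 - (x \<bullet> z)\<^sup>2" "v \<bullet> v = 1 - (z \<bullet> y)\<^sup>2"
    using assms by (simp_all add: u_def v_def norm_1_iff algebra_simps inner_commute power2_eq_square)
  then have n: "norm u = sin a" "norm v = sin b"
    using ab sin_squared_eq[of a] sin_squared_eq[of b] sin_ge_zero[of a] sin_ge_zero[of b]
    by (metis norm_eq_sqrt_inner real_sqrt_abs abs_of_nonneg)+
  have "u \<bullet> v = x \<bullet> y - (x \<bullet> z) * (z \<bullet> y)"
    using z by (simp add: u_def v_def norm_1_iff algebra_simps inner_commute)
  moreover have "- (sin a * sin b) \<le> u \<bullet> v"
    using Cauchy_Schwarz_ineq2[of u v] n by simp
  ultimately have "cos (a + b) \<le> x \<bullet> y" using ab by (simp add: cos_add)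
  then show ?thesis using True ab x y by (simp add: sphere_angle_le_iff a_def b_def)
next
  case False
  then show ?thesis using sphere_angle_bounds[OF x y] by linarith
qed

text \<open>Walk the distance \<open>a\<close> from \<open>x\<close> along a great circle through
  \<open>y\<close>; for \<open>y = - x\<close> the frame singles out one such circle.\<close>

lemma sphere_angle_split:
  fixes x y :: "'a::real_inner"
  assumes dim: "dim_at_least 3 TYPE('a)" and x: "norm x = 1" and y: "norm y = 1"
    and a: "0 \<le> a" "a \<le> sphere_angle x y"
  obtains z where "norm z = 1" "sphere_angle x z = a" "sphere_angle z y = sphere_angle x y - a"
proof -
  define t where "t = sphere_angle x y"
  have t: "0 \<le> t" "t \<le> pi" "x \<bullet> y = cos t"
    using sphere_angle_bounds[OF x y] cos_sphere_angle[OF x y] unfolding t_def by simp_all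
  obtain e k where e: "norm e = 1" "x \<bullet> e = 0" "0 \<le> k" "y = (x \<bullet> y) *\<^sub>R x + k *\<^sub>R e"
    using exists_frame[OF dim x, of y] by blast
  define w where "w = (x \<bullet> y) *\<^sub>R x + k *\<^sub>R e"
  have "y = w" using e(4) by (simp add: w_def)
  have "w \<bullet> w = (cos t)\<^sup>2 + k\<^sup>2"
    unfolding w_def t(3)
    using x e(1,2) by (simp add: norm_1_iff algebra_simps inner_commute power2_eq_square)
  then have "k\<^sup>2 = (sin t)\<^sup>2" using y \<open>y = w\<close> by (simp add: norm_1_iff sin_squared_eq)
  then have "k = sin t" using e(3) sin_ge_zero[OF t(1,2)] by simp
  then have y_eq: "y = cos t *\<^sub>R x + sin t *\<^sub>R e" using \<open>y = w\<close> t(3) by (simp add: w_def)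
  define z where "z = cos a *\<^sub>R x + sin a *\<^sub>R e"
  have "z \<bullet> z = (cos a)\<^sup>2 + (sin a)\<^sup>2"
    using x e(1,2) by (simp add: z_def norm_1_iff algebra_simps inner_commute power2_eq_square)
  then have "norm z = 1" by (simp add: norm_1_iff)
  moreover have "x \<bullet> z = cos a"
    using x e(1,2) by (simp add: z_def norm_1_iff inner_add_right)
  then have "sphere_angle x z = a"
    using a t(2) by (simp add: sphere_angle_def[of x z] arccos_cos flip: t_def)
  moreover have "z \<bullet> y = cos (t - a)"
    unfolding y_eq using x e(1,2) by (simp add: z_def norm_1_iff algebra_simps inner_commute cos_diff)
  then have "sphere_angle z y = t - a"
    using a t(2) by (simp add: sphere_angle_def[of z y] arccos_cos flip: t_def)
  ultimately show ?thesis using that t_def by blast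
qed

text \<open>The triangle inequality is sharp, since \<open>z\<close> can be taken on a geodesic arc.
  This makes balls of radius \<open>a + b\<close> definable from balls of radii \<open>a\<close> and
  \<open>b\<close>.\<close>

lemma two_step_le:
  fixes x y :: "'a::real_inner"
  assumes "dim_at_least 3 TYPE('a)" and x: "norm x = 1" and y: "norm y = 1"
    and "0 \<le> a" "0 \<le> b"
  shows "(\<exists>z\<in>sphere 0 1. sphere_angle x z \<le> a \<and> sphere_angle z y \<le> b)
    \<longleftrightarrow> sphere_angle x y \<le> a + b" (is "?L \<longleftrightarrow> ?R")
proof
  assume ?L
  then show ?R using sphere_angle_triangle[OF x y] by fastforce
next
  assume ?R
  obtain z where "norm z = 1" "sphere_angle x z = min a (sphere_angle x y)"
      "sphere_angle z y = sphere_angle x y - min a (sphere_angle x y)"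
    using sphere_angle_split[OF assms(1-3), of "min a (sphere_angle x y)"]
      assms(4) sphere_angle_bounds[OF x y] by auto
  then show ?L using \<open>?R\<close> assms(4,5) by (intro bexI[of _ z]) auto
qed

lemma two_step_le_less:
  fixes x y :: "'a::real_inner"
  assumes "dim_at_least 3 TYPE('a)" and x: "norm x = 1" and y: "norm y = 1"
    and "0 \<le> a" "0 < b"
  shows "(\<exists>z\<in>sphere 0 1. sphere_angle x z \<le> a \<and> sphere_angle z y < b)
    \<longleftrightarrow> sphere_angle x y < a + b" (is "?L \<longleftrightarrow> ?R")
proof
  assume ?L
  then show ?R using sphere_angle_triangle[OF x y] by fastforce
next
  assume ?R
  obtain z where "norm z = 1" "sphere_angle x z = min a (sphere_angle x y)"
      "sphere_angle z y = sphere_angle x y - min a (sphere_angle x y)"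
    using sphere_angle_split[OF assms(1-3), of "min a (sphere_angle x y)"]
      assms(4) sphere_angle_bounds[OF x y] by auto
  then show ?L using \<open>?R\<close> assms(4,5) by (intro bexI[of _ z]) auto
qed

lemma two_step_less:
  fixes x y :: "'a::real_inner"
  assumes "dim_at_least 3 TYPE('a)" and x: "norm x = 1" and y: "norm y = 1"
    and "0 < a" "0 < b"
  shows "(\<exists>z\<in>sphere 0 1. sphere_angle x z < a \<and> sphere_angle z y < b)
    \<longleftrightarrow> sphere_angle x y < a + b" (is "?L \<longleftrightarrow> ?R")
proof
  assume ?L
  then show ?R using sphere_angle_triangle[OF x y] by fastforce
next
  assume ?R
  \<comment> \<open>Any \<open>a'\<close> strictly between \<open>m\<close> and \<open>a\<close>
    still leaves \<open>a' + b\<close> above the angle, so the first step may be bounded by the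
    closed condition with \<open>a'\<close>.\<close>
  define m where "m = max 0 (sphere_angle x y - b)"
  have m: "0 \<le> m" "m < a" "sphere_angle x y \<le> m + b"
    using \<open>?R\<close> assms(4,5) by (auto simp: m_def max_def)
  obtain a' where "m < a'" "a' < a" using dense[OF m(2)] by blast
  then have a': "0 \<le> a'" "a' < a" "sphere_angle x y < a' + b" using m by linarith+
  then show ?L using two_step_le_less[OF assms(1-3), of a' b] assms(5) by force
qed

section \<open>Configurations on the sphere\<close>

text \<open>Everything follows from
  \<open>w \<bullet> w = 2 * (x \<bullet> y - (2 * c\<^sup>2 - 1))\<close> for the vector
  \<open>w\<close> below: the left side is nonnegative, and it vanishes only for
  \<open>w = 0\<close>, which leaves a single \<open>z\<close> if
  \<open>c \<noteq> 0\<close>.\<close>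

lemma common_neighbour_bound:
  fixes x y z :: "'a::real_inner"
  assumes "norm x = 1" "norm y = 1" "norm z = 1" and "x \<bullet> z = c" "z \<bullet> y = c"
  shows "2 * c\<^sup>2 - 1 \<le> x \<bullet> y" and "x \<bullet> y = 2 * c\<^sup>2 - 1 \<Longrightarrow> (2 * c) *\<^sub>R z = x + y"
proof -
  define w where "w = x + y - (2 * c) *\<^sub>R z"
  have "w \<bullet> w = 2 * (x \<bullet> y - (2 * c\<^sup>2 - 1))"
    using assms by (simp add: w_def norm_1_iff algebra_simps inner_commute power2_eq_square)
  then show "2 * c\<^sup>2 - 1 \<le> x \<bullet> y" and "x \<bullet> y = 2 * c\<^sup>2 - 1 \<Longrightarrow> (2 * c) *\<^sub>R z = x + y"
    using inner_ge_zero[of w] by (simp_all add: w_def)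
qed

lemma inner_self_kite:
  fixes x y e :: "'a::real_inner"
  assumes "norm x = 1" "norm y = 1" "norm e = 1" "e \<bullet> x = 0" "e \<bullet> y = 0"
  shows "(l *\<^sub>R (x + y) + k *\<^sub>R e) \<bullet> (l *\<^sub>R (x + y) + k *\<^sub>R e) = l\<^sup>2 * (2 * (1 + x \<bullet> y)) + k\<^sup>2"
  using assms by (simp add: norm_1_iff algebra_simps inner_commute power2_eq_square)

text \<open>The witnesses are mirror images in the span of \<open>x\<close> and \<open>y\<close>:
  \<open>x + y\<close> is scaled to have inner product \<open>c\<close> with both points, and a
  multiple of \<open>e\<close> completes it to norm \<open>1\<close>. That multiple is
  \<open>0\<close> only in the extremal case.\<close>

lemma common_neighbour_exists:
  fixes x y :: "'a::real_inner"
  assumes dim: "dim_at_least 3 TYPE('a)" and x: "norm x = 1" and y: "norm y = 1"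
    and c: "c \<noteq> 0" "2 * c\<^sup>2 - 1 \<le> x \<bullet> y"
  obtains z z' where "norm z = 1" "norm z' = 1" "x \<bullet> z = c" "z \<bullet> y = c" "x \<bullet> z' = c" "z' \<bullet> y = c"
    "2 * c\<^sup>2 - 1 < x \<bullet> y \<Longrightarrow> z \<noteq> z'"
proof -
  obtain e where e: "norm e = 1" "e \<bullet> x = 0" "e \<bullet> y = 0"
    using exists_unit_orthogonal[OF dim x] by blast
  define u where "u = 1 + x \<bullet> y"
  have "c\<^sup>2 > 0" using c by simp
  then have u: "u > 0" "2 * c\<^sup>2 \<le> u" using c(2) unfolding u_def by linarith+
  define m where "m = sqrt (1 - 2 * c\<^sup>2 / u)"
  have m: "m\<^sup>2 = 1 - 2 * c\<^sup>2 / u" using u by (simp add: m_def)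
  define v where "v k = (c / u) *\<^sub>R (x + y) + k *\<^sub>R e" for k
  have vx: "x \<bullet> v k = c" "v k \<bullet> y = c" for k
    using x y e u by (simp_all add: v_def norm_1_iff inner_simps inner_commute)
      (simp_all add: u_def inner_commute field_simps)
  have "v k \<bullet> v k = (c / u)\<^sup>2 * (2 * u) + k\<^sup>2" for k
    unfolding v_def u_def using x y e by (intro inner_self_kite) auto
  moreover have "(c / u)\<^sup>2 * (2 * u) = 2 * c\<^sup>2 / u"
    using u by (simp add: power2_eq_square)
  ultimately have "v k \<bullet> v k = 1" if "k\<^sup>2 = m\<^sup>2" for k
    using that m by simp
  then have "norm (v m) = 1" "norm (v (- m)) = 1" by (simp_all add: norm_1_iff)
  moreover have "v m \<noteq> v (- m)" if "2 * c\<^sup>2 - 1 < x \<bullet> y"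
  proof
    assume "v m = v (- m)"
    moreover have "e \<bullet> v k = k" for k using e by (simp add: v_def norm_1_iff inner_simps)
    ultimately have "m = - m" by metis
    then have "m = 0" by simp
    then show False using that u m by (simp add: u_def)
  qed
  ultimately show ?thesis using vx that by blast
qed

section \<open>Rhombi whose side equals the short diagonal\<close>

text \<open>Cauchy-Schwarz for \<open>x + y\<close> and \<open>z + w\<close>: their inner product
  adds up the cosines of the four sides, while \<open>x \<bullet> y \<le> C\<close> keeps
  \<open>x + y\<close> short, so \<open>z + w\<close> must be long. With \<open>C = cos r\<close>,
  the bound is the cosine of the long diagonal.\<close>

lemma rhombus_bound:
  fixes x y z w :: "'a::real_inner"
  assumes "norm x = 1" "norm y = 1" "norm z = 1" "norm w = 1" and C: "0 < C" "x \<bullet> y \<le> C"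
  shows "C \<le> x \<bullet> z \<Longrightarrow> C \<le> y \<bullet> z \<Longrightarrow> C \<le> x \<bullet> w \<Longrightarrow> C \<le> y \<bullet> w \<Longrightarrow> 4 * C\<^sup>2 / (1 + C) - 1 \<le> z \<bullet> w"
    and "C < x \<bullet> z \<Longrightarrow> C < y \<bullet> z \<Longrightarrow> C < x \<bullet> w \<Longrightarrow> C < y \<bullet> w \<Longrightarrow> 4 * C\<^sup>2 / (1 + C) - 1 < z \<bullet> w"
proof -
  define p where "p = (x + y) \<bullet> (z + w)"
  have p: "p = x \<bullet> z + y \<bullet> z + x \<bullet> w + y \<bullet> w" by (simp add: p_def inner_simps)
  have zw: "0 \<le> 1 + z \<bullet> w" using inner_bounds(2)[OF assms(3,4)] by simp
  have "p\<^sup>2 \<le> ((x + y) \<bullet> (x + y)) * ((z + w) \<bullet> (z + w))"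
    unfolding p_def by (rule Cauchy_Schwarz_ineq)
  also have "\<dots> = (2 + 2 * (x \<bullet> y)) * (2 + 2 * (z \<bullet> w))"
    using assms by (simp add: norm_1_iff inner_simps inner_commute algebra_simps)
  also have "\<dots> \<le> (2 + 2 * C) * (2 + 2 * (z \<bullet> w))"
    using C zw by (intro mult_right_mono) auto
  finally have le: "p\<^sup>2 \<le> 4 * ((1 + C) * (1 + z \<bullet> w))" by (simp add: algebra_simps)
  {
    assume "C \<le> x \<bullet> z" "C \<le> y \<bullet> z" "C \<le> x \<bullet> w" "C \<le> y \<bullet> w"
    then have "(4 * C)\<^sup>2 \<le> p\<^sup>2" using C p by (intro power_mono) auto
    then show "4 * C\<^sup>2 / (1 + C) - 1 \<le> z \<bullet> w" using le C by (simp add: field_simps power_mult_distrib)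
  }
  {
    assume "C < x \<bullet> z" "C < y \<bullet> z" "C < x \<bullet> w" "C < y \<bullet> w"
    then have "(4 * C)\<^sup>2 < p\<^sup>2" using C p by (intro power_strict_mono) auto
    then show "4 * C\<^sup>2 / (1 + C) - 1 < z \<bullet> w" using le C by (simp add: field_simps power_mult_distrib)
  }
qed

lemma rhombus_exists:
  fixes z w :: "'a::real_inner"
  assumes dim: "dim_at_least 3 TYPE('a)" and z: "norm z = 1" and w: "norm w = 1"
    and C: "0 < C" "C < 1" "4 * C\<^sup>2 / (1 + C) - 1 \<le> z \<bullet> w"
  obtains x y where "norm x = 1" "norm y = 1" "x \<bullet> y = C"
    "C \<le> x \<bullet> z" "C \<le> y \<bullet> z" "C \<le> x \<bullet> w" "C \<le> y \<bullet> w"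
    "4 * C\<^sup>2 / (1 + C) - 1 < z \<bullet> w \<Longrightarrow> C < x \<bullet> z \<and> C < y \<bullet> z \<and> C < x \<bullet> w \<and> C < y \<bullet> w"
proof -
  obtain e where e: "norm e = 1" "e \<bullet> z = 0" "e \<bullet> w = 0"
    using exists_unit_orthogonal[OF dim z] by blast
  define u where "u = 1 + z \<bullet> w"
  have "4 * C\<^sup>2 / (1 + C) > 0" using C by simp
  then have "u > 0" using C(3) unfolding u_def by linarith
  moreover have "4 * C\<^sup>2 \<le> u * (1 + C)" using C by (simp add: u_def field_simps)
  ultimately have u: "u > 0" "4 * C\<^sup>2 \<le> u * (1 + C)" .
  \<comment> \<open>For \<open>v n\<close> and \<open>v (- n)\<close>, norm \<open>1\<close> and
    inner product \<open>C\<close> mean \<open>2 * u * m\<^sup>2 + n\<^sup>2 = 1\<close> and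
    \<open>2 * u * m\<^sup>2 - n\<^sup>2 = C\<close>; these are the solutions.\<close>
  define m where "m = sqrt ((1 + C) / (4 * u))"
  define n where "n = sqrt ((1 - C) / 2)"
  have m: "m\<^sup>2 = (1 + C) / (4 * u)" and n: "n\<^sup>2 = (1 - C) / 2" and "m \<ge> 0" using u C by (simp_all add: m_def n_def)
  define v where "v k = m *\<^sub>R (z + w) + k *\<^sub>R e" for k
  have vz: "v k \<bullet> z = m * u" "v k \<bullet> w = m * u" for k
    using z w e by (simp_all add: v_def u_def norm_1_iff inner_simps inner_commute algebra_simps)
  have vv: "v k \<bullet> v l = 2 * u * m\<^sup>2 + k * l" for k l
    using z w e by (simp add: v_def u_def norm_1_iff algebra_simps inner_commute power2_eq_square)
  have "(m * u)\<^sup>2 = m\<^sup>2 * u\<^sup>2" by (rule power_mult_distrib)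
  also have "\<dots> = u * (1 + C) / 4" using u unfolding m by (simp add: power2_eq_square)
  finally have sq: "(m * u)\<^sup>2 = u * (1 + C) / 4" .
  have mu: "0 \<le> m * u" using \<open>m \<ge> 0\<close> u by simp
  have "C\<^sup>2 \<le> (m * u)\<^sup>2" unfolding sq using u by simp
  then have "C \<le> m * u" using mu by (rule power2_le_imp_le)
  moreover have "C < m * u" if "4 * C\<^sup>2 / (1 + C) - 1 < z \<bullet> w"
  proof -
    have "4 * C\<^sup>2 < u * (1 + C)" using that C by (simp add: u_def field_simps)
    then have "C\<^sup>2 < (m * u)\<^sup>2" unfolding sq by simp
    then show ?thesis using mu by (rule power2_less_imp_less)
  qed
  moreover have "2 * u * m\<^sup>2 = (1 + C) / 2" "n * n = (1 - C) / 2"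
    using u n unfolding m by (simp_all add: power2_eq_square)
  then have "norm (v n) = 1" "norm (v (- n)) = 1" "v n \<bullet> v (- n) = C"
    by (simp_all add: norm_1_iff vv field_simps)
  ultimately show ?thesis using that[of "v n" "v (- n)"] vz by simp
qed

section \<open>A configuration built from the angle \<open>2 * pi / 3\<close>\<close>

lemma unit_sum_eq_0:
  fixes x y z :: "'a::real_inner"
  assumes "norm x = 1" "norm y = 1" "norm z = 1"
    and "x \<bullet> y = - 1/2" "x \<bullet> z = - 1/2" "y \<bullet> z = - 1/2"
  shows "z = - (x + y)"
proof -
  have "(x + y + z) \<bullet> (x + y + z) = 0"
    using assms by (simp add: norm_1_iff inner_simps inner_commute)
  then have "x + y + z = 0" by simp
  then show ?thesis by (metis add.commute eq_neg_iff_add_eq_0)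
qed

text \<open>
  The constraints force \<open>a = - (x + z)\<close> and \<open>b = - (y + z)\<close>. In the extremal configuration
  \<open>x \<bullet> y = - 1/3\<close> and \<open>q = z - z'\<close>, and the vector \<open>v\<close> of the proof is parallel to \<open>q\<close>.
\<close>

lemma third_bound:
  fixes x y z z' q a b :: "'a::real_inner"
  assumes n: "norm x = 1" "norm y = 1" "norm z = 1" "norm z' = 1" "norm q = 1" "norm a = 1" "norm b = 1"
    and zx: "z \<bullet> x = - 1/2" "z \<bullet> y = - 1/2" "z' \<bullet> x = - 1/2" "z' \<bullet> y = - 1/2"
    and ab: "a \<bullet> x = - 1/2" "a \<bullet> z = - 1/2" "b \<bullet> y = - 1/2" "b \<bullet> z = - 1/2"
  shows "q \<bullet> z' \<le> - 1/2 \<Longrightarrow> q \<bullet> a \<le> - 1/2 \<Longrightarrow> q \<bullet> b \<le> - 1/2 \<Longrightarrow> - 1/3 \<le> x \<bullet> y"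
    and "q \<bullet> z' < - 1/2 \<Longrightarrow> q \<bullet> a < - 1/2 \<Longrightarrow> q \<bullet> b < - 1/2 \<Longrightarrow> - 1/3 < x \<bullet> y"
proof -
  have a: "a = - (x + z)" and b: "b = - (y + z)"
    using unit_sum_eq_0[of x z a] unit_sum_eq_0[of y z b] n zx ab by (simp_all add: inner_commute)
  define u g where "u = 1 + x \<bullet> y" and "g = z \<bullet> z'"
  have u: "0 \<le> u" using inner_bounds(2)[OF n(1,2)] by (simp add: u_def)
  \<comment> \<open>This bounds \<open>g\<close> from below; the inequality \<open>cs\<close> for
    \<open>q\<close> and \<open>v\<close> will bound it from above.\<close>
  have "(- 2)\<^sup>2 \<le> ((x + y) \<bullet> (x + y)) * ((z + z') \<bullet> (z + z'))"
    using Cauchy_Schwarz_ineq[of "x + y" "z + z'"] zx by (simp add: inner_simps inner_commute)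
  also have "\<dots> = (2 * u) * (2 + 2 * g)"
    using n by (simp add: u_def g_def norm_1_iff inner_simps inner_commute algebra_simps)
  finally have 1: "1 \<le> u * (1 + g)" by (simp add: algebra_simps)
  define v where "v = x + y + 2 *\<^sub>R z - (2/3) *\<^sub>R z'"
  have vv: "v \<bullet> v = 2 * u + 16/9 - (8/3) * g"
    using n zx by (simp add: v_def u_def g_def norm_1_iff inner_simps inner_commute right_diff_distrib)
  have qv: "q \<bullet> v = - (q \<bullet> a) - q \<bullet> b - (2/3) * (q \<bullet> z')"
    by (simp add: v_def a b inner_simps)
  have cs: "(q \<bullet> v)\<^sup>2 \<le> v \<bullet> v"
    using Cauchy_Schwarz_ineq[of q v] n by (simp add: norm_1_iff)
  {
    assume "q \<bullet> z' \<le> - 1/2" "q \<bullet> a \<le> - 1/2" "q \<bullet> b \<le> - 1/2"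
    \<comment> \<open>The three conditions on \<open>q\<close> contribute
      \<open>1/2 + 1/2 + (2/3) * (1/2) = 4/3\<close>.\<close>
    then have "(4/3)\<^sup>2 \<le> (q \<bullet> v)\<^sup>2" using qv by (intro power_mono) auto
    then have "g \<le> 3 * u / 4" using cs vv by (simp add: power2_eq_square)
    then have "u * (1 + g) \<le> u * (1 + 3 * u / 4)" using u by (intro mult_left_mono) auto
    \<comment> \<open>The two bounds on \<open>g\<close> combine to
      \<open>0 \<le> 3 * u\<^sup>2 / 4 + u - 1\<close>, whose only positive root is
      \<open>2/3\<close>.\<close>
    then have "0 \<le> (u - 2/3) * (3 * u / 4 + 3/2)" using 1 by (simp add: field_simps)
    then have "0 \<le> u - 2/3" using u by (auto simp: zero_le_mult_iff)
    then show "- 1/3 \<le> x \<bullet> y" by (simp add: u_def)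
  }
  {
    assume "q \<bullet> z' < - 1/2" "q \<bullet> a < - 1/2" "q \<bullet> b < - 1/2"
    then have "(4/3)\<^sup>2 < (q \<bullet> v)\<^sup>2" using qv by (intro power_strict_mono) auto
    then have "g < 3 * u / 4" using cs vv by (simp add: power2_eq_square)
    moreover have "u \<noteq> 0" using 1 by auto
    ultimately have "u * (1 + g) < u * (1 + 3 * u / 4)" using u by (intro mult_strict_left_mono) auto
    then have "0 < (u - 2/3) * (3 * u / 4 + 3/2)" using 1 by (simp add: field_simps)
    then have "0 < u - 2/3" using u by (auto simp: zero_less_mult_iff)
    then show "- 1/3 < x \<bullet> y" by (simp add: u_def)
  }
qed

text \<open>Take \<open>z\<close> and \<open>z'\<close> as mirror images in the span of
  \<open>x\<close> and \<open>y\<close>, and \<open>q = e\<close> normal to it. Then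
  \<open>q\<close> has inner product \<open>- m\<close> with each of \<open>z'\<close>,
  \<open>a\<close> and \<open>b\<close>, and \<open>1/2 \<le> m\<close> amounts to
  \<open>2/3 \<le> 1 + x \<bullet> y\<close>.\<close>

lemma third_exists:
  fixes x y :: "'a::real_inner"
  assumes dim: "dim_at_least 3 TYPE('a)" and x: "norm x = 1" and y: "norm y = 1"
    and d: "- 1/3 \<le> x \<bullet> y"
  obtains z z' q a b where
    "norm z = 1" "norm z' = 1" "norm q = 1" "norm a = 1" "norm b = 1"
    "z \<bullet> x = - 1/2" "z \<bullet> y = - 1/2" "z' \<bullet> x = - 1/2" "z' \<bullet> y = - 1/2"
    "a \<bullet> x = - 1/2" "a \<bullet> z = - 1/2" "b \<bullet> y = - 1/2" "b \<bullet> z = - 1/2"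
    "q \<bullet> z' \<le> - 1/2" "q \<bullet> a \<le> - 1/2" "q \<bullet> b \<le> - 1/2"
    "- 1/3 < x \<bullet> y \<Longrightarrow> q \<bullet> z' < - 1/2 \<and> q \<bullet> a < - 1/2 \<and> q \<bullet> b < - 1/2"
proof -
  obtain e where e: "norm e = 1" "e \<bullet> x = 0" "e \<bullet> y = 0"
    using exists_unit_orthogonal[OF dim x] by blast
  define u where "u = 1 + x \<bullet> y"
  have u: "2/3 \<le> u" using d by (simp add: u_def)
  define m where "m = sqrt (1 - 1 / (2 * u))"
  have m2: "m\<^sup>2 = 1 - 1 / (2 * u)" using u by (simp add: m_def field_simps)
  have m: "1/2 \<le> m" "- 1/3 < x \<bullet> y \<Longrightarrow> 1/2 < m"
  proof -
    show "1/2 \<le> m"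
      unfolding m_def using u by (intro real_le_rsqrt) (simp add: power2_eq_square field_simps)
    assume "- 1/3 < x \<bullet> y"
    then have "2/3 < u" by (simp add: u_def)
    then show "1/2 < m"
      unfolding m_def by (intro real_less_rsqrt) (simp add: power2_eq_square field_simps)
  qed
  define v where "v k = (- 1 / (2 * u)) *\<^sub>R (x + y) + k *\<^sub>R e" for k
  have vx: "v k \<bullet> x = - 1/2" "v k \<bullet> y = - 1/2" for k
    using x y e u by (simp_all add: v_def norm_1_iff inner_simps inner_commute)
      (simp_all add: u_def inner_commute field_simps)
  have "v k \<bullet> v k = 1 / (2 * u) + k\<^sup>2" for k
  proof -
    have "v k \<bullet> v k = (1 / (2 * u))\<^sup>2 * (2 * u) + k\<^sup>2"
      unfolding v_def u_def using inner_self_kite[OF x y e, of "- 1 / (2 * (1 + x \<bullet> y))" k] by simp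
    then show ?thesis using u by (simp add: power2_eq_square)
  qed
  then have vv: "v m \<bullet> v m = 1" "v (- m) \<bullet> v (- m) = 1" using m2 by simp_all
  have ev: "e \<bullet> v k = k" for k
    using e by (simp add: v_def norm_1_iff inner_simps)
  show ?thesis
    by (rule that[of "v m" "v (- m)" e "- (x + v m)" "- (y + v m)"])
      (use x y e vx vv ev m in \<open>simp_all add: norm_1_iff inner_simps inner_commute\<close>)
qed

section \<open>Inner product preserving maps\<close>

text \<open>The defect of additivity or homogeneity has inner product \<open>0\<close> with itself,
  because the expansion only involves inner products of values of \<open>F\<close>.\<close>

lemma linear_of_inner_preserving:
  fixes F :: "'a::real_inner \<Rightarrow> 'b::real_inner"
  assumes F: "\<And>x y. F x \<bullet> F y = x \<bullet> y"
  shows "linear F"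
proof (rule linearI)
  fix x y and c :: real
  have "(F (x + y) - F x - F y) \<bullet> (F (x + y) - F x - F y) = 0"
    by (simp add: inner_diff_left inner_diff_right F inner_add_left inner_add_right inner_commute)
  then have "F (x + y) - F x - F y = 0" by (simp only: inner_eq_zero_iff)
  then show "F (x + y) = F x + F y" by (simp add: algebra_simps)
  have "(F (c *\<^sub>R x) - c *\<^sub>R F x) \<bullet> (F (c *\<^sub>R x) - c *\<^sub>R F x) = 0"
    by (simp add: inner_diff_left inner_diff_right F)
  then show "F (c *\<^sub>R x) = c *\<^sub>R F x" by simp
qed

lemma bij_linear_isometry_of_inner_preserving:
  fixes F :: "'a::real_inner \<Rightarrow> 'a"
  assumes F: "\<And>x y. F x \<bullet> F y = x \<bullet> y"
    and onto: "\<And>y. norm y = 1 \<Longrightarrow> \<exists>x. F x = y"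
  shows "bij_linear_isometry F"
proof -
  have lin: "linear F" using F by (rule linear_of_inner_preserving)
  have norm: "norm (F x) = norm x" for x by (simp add: norm_eq_sqrt_inner F)
  have "inj F" using lin norm by (metis linear_injective_0 norm_eq_zero)
  moreover have "y \<in> range F" for y
  proof (cases "y = 0")
    case True
    then show ?thesis using linear_0[OF lin] by (metis rangeI)
  next
    case False
    then obtain x where "F x = sgn y" using onto[of "sgn y"] by (auto simp: norm_sgn)
    then have "F (norm y *\<^sub>R x) = y" using False by (simp add: linear_scale[OF lin] sgn_div_norm)
    then show ?thesis by (metis rangeI)
  qed
  then have "surj F" by auto
  ultimately show ?thesis using lin norm by (simp add: bij_linear_isometry_def bij_def)
qed

lemma inner_eq_norm_sgn: "x \<bullet> y = norm x * norm y * (sgn x \<bullet> sgn y)" for x y :: "'a::real_inner"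
  by (cases "x = 0 \<or> y = 0") (auto simp: sgn_div_norm field_simps)

text \<open>The equality case of Cauchy-Schwarz for vectors of equal norm.\<close>

lemma eq_or_eq_minus:
  fixes u w :: "'a::real_inner"
  assumes "u \<bullet> u = n" "w \<bullet> w = n" "\<bar>u \<bullet> w\<bar> = n"
  shows "u = w \<or> u = - w"
proof (cases "u \<bullet> w = n")
  case True
  then have "(u - w) \<bullet> (u - w) = 0" using assms by (simp add: inner_diff_left inner_diff_right inner_commute)
  then show ?thesis by simp
next
  case False
  then have "u \<bullet> w = - n" using assms(3) by linarith
  then have "(u + w) \<bullet> (u + w) = 0" using assms by (simp add: inner_add_left inner_add_right inner_commute)
  then show ?thesis by (simp add: eq_neg_iff_add_eq_0)
qed

section \<open>Relations preserved by a bijection of the sphere\<close>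

locale sphere_bijection =
  fixes \<psi> :: "'a::real_inner \<Rightarrow> 'a"
  assumes dim: "dim_at_least 3 TYPE('a)"
    and bij: "bij_betw \<psi> (sphere 0 1) (sphere 0 1)"
begin

lemma norm_image [simp]: "norm x = 1 \<Longrightarrow> norm (\<psi> x) = 1"
  using bij by (auto simp: bij_betw_def)

lemma ex_preimage:
  assumes "norm y = 1"
  obtains x where "norm x = 1" "y = \<psi> x"
proof -
  have "y \<in> \<psi> ` sphere 0 1" using bij assms by (simp add: bij_betw_def)
  then show ?thesis using that by auto
qed

lemma bex_sphere_image: "(\<exists>z\<in>sphere 0 1. Q z) \<longleftrightarrow> (\<exists>z\<in>sphere 0 1. Q (\<psi> z))"
  using bij by (metis bij_betw_imp_surj_on image_iff)

definition preserves :: "('a \<Rightarrow> 'a \<Rightarrow> bool) \<Rightarrow> bool" where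
  "preserves U \<longleftrightarrow> (\<forall>x\<in>sphere 0 1. \<forall>y\<in>sphere 0 1. U x y \<longleftrightarrow> U (\<psi> x) (\<psi> y))"

lemma preservesD:
  assumes "preserves U" "norm x = 1" "norm y = 1"
  shows "U (\<psi> x) (\<psi> y) \<longleftrightarrow> U x y"
  using assms by (auto simp: preserves_def)

lemma preserves_cong:
  assumes "preserves U" and "\<And>x y. norm x = 1 \<Longrightarrow> norm y = 1 \<Longrightarrow> U x y \<longleftrightarrow> V x y"
  shows "preserves V"
  using assms norm_image by (auto simp: preserves_def)

lemma preserves_not: "preserves U \<Longrightarrow> preserves (\<lambda>x y. \<not> U x y)"
  by (auto simp: preserves_def)

text \<open>Surjectivity of \<open>\<psi>\<close> lets the intermediate point be sought among the
  images.\<close>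

lemma preserves_comp:
  assumes "preserves U" "preserves V"
  shows "preserves (\<lambda>x y. \<exists>z\<in>sphere 0 1. U x z \<and> V z y)"
  unfolding preserves_def
proof (intro ballI)
  fix x y :: 'a
  assume "x \<in> sphere 0 1" "y \<in> sphere 0 1"
  then show "(\<exists>z\<in>sphere 0 1. U x z \<and> V z y) \<longleftrightarrow> (\<exists>z\<in>sphere 0 1. U (\<psi> x) z \<and> V z (\<psi> y))"
    by (subst (2) bex_sphere_image) (use assms in \<open>auto simp: preserves_def\<close>)
qed

end

section \<open>Orthogonality\<close>

text \<open>Normalised to \<open>p s = f s / f 1\<close> and \<open>q s = g s / g 1\<close>, both
  maps are multiplicative, then equal, then additive. A field endomorphism of the reals is the
  identity, and \<open>f 1\<close> is \<open>1\<close> or \<open>- 1\<close>.\<close>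

lemma orthogonality_coordinates:
  fixes f g :: "real \<Rightarrow> real"
  assumes *: "\<And>s t u v. 1 + s * u + t * v = 0 \<longleftrightarrow> 1 + f s * f u + g t * g v = 0"
    and "f 0 = 0" "g 0 = 0"
  shows "\<bar>f s\<bar> = \<bar>s\<bar>"
proof -
  define a b where "a = f 1" and "b = g 1"
  \<comment> \<open>For \<open>t = 1\<close> and \<open>v = - 1 - s * u\<close> the left equation
    holds, so \<open>f s * f u\<close> depends only on the product \<open>s * u\<close>.\<close>
  have F: "f s * f u = - 1 - g 1 * g (- 1 - s * u)" for s u
    using *[of s u 1 "- 1 - s * u"] by (simp add: algebra_simps)
  have f_mult: "f s * f u = a * f (s * u)" for s u
    using F[of s u] F[of 1 "s * u"] by (simp add: a_def)
  have G: "g s * g u = - 1 - f 1 * f (- 1 - s * u)" for s u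
    using *[of 1 "- 1 - s * u" s u] by (simp add: algebra_simps)
  have g_mult: "g s * g u = b * g (s * u)" for s u
    using G[of s u] G[of 1 "s * u"] by (simp add: b_def)
  have "f 1 * f (- 1) = - 1" "g 1 * g (- 1) = - 1"
    using F[of 1 "- 1"] G[of 1 "- 1"] assms by simp_all
  then have ab0: "a \<noteq> 0" "b \<noteq> 0" by (auto simp: a_def b_def)
  define p q where "p s = f s / a" and "q s = g s / b" for s
  have p_mult: "p (s * u) = p s * p u" and q_mult: "q (s * u) = q s * q u" for s u
    using f_mult[of s u] g_mult[of s u] ab0 by (simp_all add: p_def q_def field_simps)
  have p1: "p 1 = 1" "q 1 = 1" and p0: "p 0 = 0" "q 0 = 0"
    using ab0 assms by (simp_all add: p_def q_def a_def b_def)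
  have ap: "a\<^sup>2 * p (- 1) = - 1" "b\<^sup>2 * q (- 1) = - 1"
    using \<open>f 1 * f (- 1) = - 1\<close> \<open>g 1 * g (- 1) = - 1\<close> ab0
    by (simp_all add: p_def q_def a_def b_def power2_eq_square)
  \<comment> \<open>\<open>p (- 1) = 1\<close> is excluded, since
    \<open>a\<^sup>2 * p (- 1) = - 1\<close> would make \<open>a\<^sup>2\<close> negative; likewise
    for \<open>q\<close>.\<close>
  have "(p (- 1))\<^sup>2 = 1" "(q (- 1))\<^sup>2 = 1"
    using p_mult[of "- 1" "- 1"] q_mult[of "- 1" "- 1"] p1 by (simp_all add: power2_eq_square)
  moreover have "a\<^sup>2 \<noteq> - 1" "b\<^sup>2 \<noteq> - 1"
    using zero_le_power2[of a] zero_le_power2[of b] by linarith+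
  ultimately have pm1: "p (- 1) = - 1" "q (- 1) = - 1"
    using ap unfolding power2_eq_1_iff by auto
  then have a2: "a\<^sup>2 = 1" "b\<^sup>2 = 1" using ap by simp_all
  have odd: "p (- s) = - p s" "q (- s) = - q s" for s
    using p_mult[of "- 1" s] q_mult[of "- 1" s] pm1 by simp_all
  have sum: "p s + q (- 1 - s) = - 1" for s
  proof -
    have "a * f s + b * g (- 1 - s) = - 1"
      using *[of 1 s 1 "- 1 - s"] by (simp add: a_def b_def)
    moreover have "a * f s = a\<^sup>2 * p s" "b * g (- 1 - s) = b\<^sup>2 * q (- 1 - s)"
      using ab0 by (simp_all add: p_def q_def power2_eq_square)
    ultimately show ?thesis by (simp only: a2 mult_1_left)
  qed
  have qp: "q (1 + s) = 1 + p s" for s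
    using sum[of s] odd(2)[of "1 + s"] by simp
  have pq: "p (1 + s) = 1 + q s" for s
    using sum[of "- 1 - s"] odd(1)[of "1 + s"] by simp
  have q2: "q (2 + s) = 2 + q s" for s
    using qp[of "1 + s"] pq[of s] by simp
  have "q 2 = 2" using q2[of 0] p0 by simp
  \<comment> \<open>Put \<open>2 * s\<close> into the shift by \<open>2\<close> and cancel the
    factor \<open>q 2 = 2\<close>.\<close>
  have "q (1 + s) = 1 + q s" for s
    using q2[of "2 * s"] q_mult[of 2 "1 + s"] q_mult[of 2 s] \<open>q 2 = 2\<close> by (simp add: algebra_simps)
  then have "p s = q s" for s using qp[of s] by simp
  then have "p = q" by (rule ext)
  have p_add: "p (s + u) = p s + p u" for s u
  proof (cases "s = 0")
    case False
    have "p (s + u) = p s * p (1 + u / s)"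
      using False by (simp only: p_mult[symmetric]) (simp add: distrib_left)
    also have "\<dots> = p s * (1 + p (u / s))" using pq \<open>p = q\<close> by simp
    also have "\<dots> = p s + p (s * (u / s))" by (simp only: p_mult distrib_left mult_1_right)
    also have "\<dots> = p s + p u" using False by simp
    finally show ?thesis .
  qed (simp add: p0)
  have "p s = s" for s
  proof -
    \<comment> \<open>Nonnegative reals are squares, so the additive and multiplicative
      \<open>p\<close> is monotone; being the identity on the rationals, it is the identity.\<close>
    have nn: "0 \<le> p s" if "0 \<le> s" for s
      using that p_mult[of "sqrt s" "sqrt s"] by simp
    have le: "p s \<le> p u" if "s \<le> u" for s u
      using p_add[of s "u - s"] nn[of "u - s"] that by simp
    have p_nat: "p (real n * s) = real n * p s" for n s
      by (induction n) (simp_all add: p0 p_add distrib_right)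
    have p_int: "p (of_int n * s) = of_int n * p s" for n s
      by (cases n rule: int_cases2) (simp_all add: p_nat odd)
    have p_rat: "p r = r" if r: "r \<in> \<rat>" for r
    proof -
      obtain m n :: int where mn: "n \<noteq> 0" "r = of_int m / of_int n"
        using r unfolding Rats_eq_int_div_int by blast
      then have nr: "of_int n * r = of_int m * 1" by simp
      have "of_int n * p r = of_int n * r"
        unfolding p_int[symmetric] nr by (simp only: p_int p1)
      then show ?thesis using mn(1) by simp
    qed
    show ?thesis
    proof (rule ccontr)
      assume "p s \<noteq> s"
      then consider "p s < s" | "s < p s" by linarith
      then show False
      proof cases
        case 1
        then obtain r where "r \<in> \<rat>" "p s < r" "r < s" using Rats_dense_in_real by blast
        then show False using le[of r s] p_rat by simp
      next
        case 2
        then obtain r where "r \<in> \<rat>" "s < r" "r < p s" using Rats_dense_in_real by blast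
        then show False using le[of s r] p_rat by simp
      qed
    qed
  qed
  then have "f s = a * s" using ab0 by (simp add: p_def field_simps)
  moreover have "\<bar>a\<bar> = 1" using a2 by (simp add: abs_square_eq_1)
  ultimately show ?thesis by (simp add: abs_mult)
qed

section \<open>From orthogonality to absolute values of inner products\<close>

context sphere_bijection
begin

context
  assumes orth: "preserves (\<lambda>x y. x \<bullet> y = 0)"
begin

lemma orth_iff: "norm x = 1 \<Longrightarrow> norm y = 1 \<Longrightarrow> \<psi> x \<bullet> \<psi> y = 0 \<longleftrightarrow> x \<bullet> y = 0"
  using preservesD[OF orth] .

text \<open>A nonzero remainder \<open>w\<close> would have the direction of some
  \<open>\<psi> z\<close>. Then \<open>z\<close> is orthogonal to \<open>e1\<close>,
  \<open>e2\<close>, \<open>e3\<close>, hence to \<open>v\<close>, so \<open>w\<close> is orthogonal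
  to \<open>\<psi> v\<close>, which forces \<open>w \<bullet> w = 0\<close>.\<close>

lemma image_in_span:
  assumes n: "norm e1 = 1" "norm e2 = 1" "norm e3 = 1"
    and o: "e1 \<bullet> e2 = 0" "e1 \<bullet> e3 = 0" "e2 \<bullet> e3 = 0"
    and v: "norm v = 1" "v = a *\<^sub>R e1 + b *\<^sub>R e2 + c *\<^sub>R e3"
  shows "\<psi> v = (\<psi> v \<bullet> \<psi> e1) *\<^sub>R \<psi> e1 + (\<psi> v \<bullet> \<psi> e2) *\<^sub>R \<psi> e2 + (\<psi> v \<bullet> \<psi> e3) *\<^sub>R \<psi> e3"
proof -
  define w where "w = \<psi> v - (\<psi> v \<bullet> \<psi> e1) *\<^sub>R \<psi> e1 - (\<psi> v \<bullet> \<psi> e2) *\<^sub>R \<psi> e2 - (\<psi> v \<bullet> \<psi> e3) *\<^sub>R \<psi> e3"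
  have on: "\<psi> e1 \<bullet> \<psi> e1 = 1" "\<psi> e2 \<bullet> \<psi> e2 = 1" "\<psi> e3 \<bullet> \<psi> e3 = 1"
      "\<psi> e1 \<bullet> \<psi> e2 = 0" "\<psi> e1 \<bullet> \<psi> e3 = 0" "\<psi> e2 \<bullet> \<psi> e3 = 0"
      "\<psi> e2 \<bullet> \<psi> e1 = 0" "\<psi> e3 \<bullet> \<psi> e1 = 0" "\<psi> e3 \<bullet> \<psi> e2 = 0"
    using n o by (simp_all add: orth_iff inner_commute flip: norm_1_iff)
  have w: "w \<bullet> \<psi> e1 = 0" "w \<bullet> \<psi> e2 = 0" "w \<bullet> \<psi> e3 = 0"
    by (simp_all add: w_def inner_diff_left on)
  have "w = 0"
  proof (rule ccontr)
    assume "w \<noteq> 0"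
    then obtain z where z: "norm z = 1" "sgn w = \<psi> z"
      using ex_preimage[of "sgn w"] by (auto simp: norm_sgn)
    have "\<psi> z \<bullet> \<psi> e1 = 0" "\<psi> z \<bullet> \<psi> e2 = 0" "\<psi> z \<bullet> \<psi> e3 = 0"
      using w by (simp_all add: sgn_div_norm flip: z(2))
    then have "z \<bullet> e1 = 0" "z \<bullet> e2 = 0" "z \<bullet> e3 = 0" using n z by (simp_all add: orth_iff)
    then have "z \<bullet> v = 0" by (subst v(2)) (simp add: inner_simps)
    then have "sgn w \<bullet> \<psi> v = 0" using z v(1) by (simp add: orth_iff)
    then have wv: "w \<bullet> \<psi> v = 0" using \<open>w \<noteq> 0\<close> by (simp add: sgn_div_norm)
    have "w \<bullet> w = w \<bullet> \<psi> v"
      by (subst (2) w_def) (simp add: inner_diff_right w)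
    then show False using wv \<open>w \<noteq> 0\<close> by simp
  qed
  then show ?thesis by (simp add: w_def algebra_simps)
qed

text \<open>In the chart \<open>(1, s, t)\<close> of directions not orthogonal to \<open>e1\<close>,
  the map becomes \<open>(1, A s t, B s t)\<close>. Orthogonality makes \<open>A\<close> independent
  of \<open>t\<close> and \<open>B\<close> of \<open>s\<close>, so
  \<open>orthogonality_coordinates\<close> applies.\<close>

lemma image_slope:
  assumes n: "norm e1 = 1" "norm e2 = 1" "norm e3 = 1"
    and o: "e1 \<bullet> e2 = 0" "e1 \<bullet> e3 = 0" "e2 \<bullet> e3 = 0"
  shows "\<bar>\<psi> (sgn (e1 + s *\<^sub>R e2)) \<bullet> \<psi> e2\<bar> = \<bar>s\<bar> * \<bar>\<psi> (sgn (e1 + s *\<^sub>R e2)) \<bullet> \<psi> e1\<bar>"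
proof -
  have on: "e1 \<bullet> e1 = 1" "e2 \<bullet> e2 = 1" "e3 \<bullet> e3 = 1"
      "e1 \<bullet> e2 = 0" "e1 \<bullet> e3 = 0" "e2 \<bullet> e3 = 0" "e2 \<bullet> e1 = 0" "e3 \<bullet> e1 = 0" "e3 \<bullet> e2 = 0"
    using n o by (simp_all add: inner_commute flip: norm_1_iff)
  have on': "\<psi> e1 \<bullet> \<psi> e1 = 1" "\<psi> e2 \<bullet> \<psi> e2 = 1" "\<psi> e3 \<bullet> \<psi> e3 = 1"
      "\<psi> e1 \<bullet> \<psi> e2 = 0" "\<psi> e1 \<bullet> \<psi> e3 = 0" "\<psi> e2 \<bullet> \<psi> e3 = 0"
      "\<psi> e2 \<bullet> \<psi> e1 = 0" "\<psi> e3 \<bullet> \<psi> e1 = 0" "\<psi> e3 \<bullet> \<psi> e2 = 0"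
    using n o by (simp_all add: orth_iff inner_commute flip: norm_1_iff)
  define v where "v s t = e1 + s *\<^sub>R e2 + t *\<^sub>R e3" for s t
  define T where "T x = \<psi> (sgn x)" for x
  have T_orth: "T x \<bullet> T y = 0 \<longleftrightarrow> x \<bullet> y = 0" if "x \<noteq> 0" "y \<noteq> 0" for x y
    using that by (simp add: T_def orth_iff norm_sgn) (simp add: sgn_div_norm)
  have T_e: "T e1 = \<psi> e1" "T e2 = \<psi> e2" "T e3 = \<psi> e3"
    using n by (simp_all add: T_def sgn_div_norm)
  have v1: "v s t \<bullet> e1 = 1" and v2: "v s t \<bullet> e2 = s" and v3: "v s t \<bullet> e3 = t" for s t
    by (simp_all add: v_def inner_add_left on)
  have v0: "v s t \<noteq> 0" and e0: "e1 \<noteq> 0" "e2 \<noteq> 0" "e3 \<noteq> 0" for s t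
    using v1[of s t] on by auto
  have vv: "v s t \<bullet> v s' t' = 1 + s * s' + t * t'" for s t s' t'
    by (simp add: v_def inner_simps on)
  define A B c where "A s t = (T (v s t) \<bullet> \<psi> e2) / (T (v s t) \<bullet> \<psi> e1)"
    and "B s t = (T (v s t) \<bullet> \<psi> e3) / (T (v s t) \<bullet> \<psi> e1)" and "c s t = T (v s t) \<bullet> \<psi> e1" for s t
  have c0: "c s t \<noteq> 0" for s t
    using T_orth[OF v0 e0(1), of s t] v1[of s t] by (simp add: T_e c_def)
  have Tv: "T (v s t) = c s t *\<^sub>R (\<psi> e1 + A s t *\<^sub>R \<psi> e2 + B s t *\<^sub>R \<psi> e3)" for s t
  proof -
    have "sgn (v s t) = inverse (norm (v s t)) *\<^sub>R e1 + (inverse (norm (v s t)) * s) *\<^sub>R e2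
        + (inverse (norm (v s t)) * t) *\<^sub>R e3"
      by (simp add: sgn_div_norm v_def scaleR_add_right)
    moreover have "norm (sgn (v s t)) = 1" using v0[of s t] by (simp add: norm_sgn)
    ultimately have "T (v s t) = (T (v s t) \<bullet> \<psi> e1) *\<^sub>R \<psi> e1 + (T (v s t) \<bullet> \<psi> e2) *\<^sub>R \<psi> e2 + (T (v s t) \<bullet> \<psi> e3) *\<^sub>R \<psi> e3"
      unfolding T_def by (intro image_in_span[OF n o])
    moreover have "T (v s t) \<bullet> \<psi> e2 = c s t * A s t" "T (v s t) \<bullet> \<psi> e3 = c s t * B s t"
      using c0[of s t] by (simp_all add: A_def B_def c_def)
    ultimately have "T (v s t) = c s t *\<^sub>R \<psi> e1 + (c s t * A s t) *\<^sub>R \<psi> e2 + (c s t * B s t) *\<^sub>R \<psi> e3"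
      by (simp only: c_def)
    then show ?thesis by (simp only: scaleR_add_right scaleR_scaleR)
  qed
  have AB: "1 + s * s' + t * t' = 0 \<longleftrightarrow> 1 + A s t * A s' t' + B s t * B s' t' = 0" for s t s' t'
  proof -
    have "T (v s t) \<bullet> T (v s' t') = (c s t * c s' t') * (1 + A s t * A s' t' + B s t * B s' t')"
      unfolding Tv by (simp add: inner_simps on' algebra_simps)
    then show ?thesis
      using T_orth[OF v0 v0, of s t s' t'] c0[of s t] c0[of s' t'] by (simp add: vv)
  qed
  have A0: "A 0 t = 0" and B0: "B s 0 = 0" for s t
    using T_orth[OF v0 e0(2), of 0 t] T_orth[OF v0 e0(3), of s 0]
    by (simp_all add: v2 v3 A_def B_def T_e)
  \<comment> \<open>For \<open>s \<noteq> 0\<close>, \<open>v (- 1 / s) 0\<close> is orthogonal to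
    both \<open>v s t\<close> and \<open>v s 0\<close>, and its \<open>B\<close> coordinate
    vanishes; so one and the same equation determines \<open>A s t\<close> and
    \<open>A s 0\<close>.\<close>
  have A_eq: "A s t = A s 0" for s t
  proof (cases "s = 0")
    case False
    then have "1 + A s t * A (- 1 / s) 0 = 0" "1 + A s 0 * A (- 1 / s) 0 = 0"
      using AB[of s "- 1 / s" t 0] AB[of s "- 1 / s" 0 0] by (simp_all add: B0)
    then show ?thesis by (metis add_left_cancel mult_cancel_right mult_zero_right zero_neq_one add.right_neutral)
  qed (simp add: A0)
  have B_eq: "B s t = B 0 t" for s t
  proof (cases "t = 0")
    case False
    then have "1 + B s t * B 0 (- 1 / t) = 0" "1 + B 0 t * B 0 (- 1 / t) = 0"
      using AB[of s 0 t "- 1 / t"] AB[of 0 0 t "- 1 / t"] by (simp_all add: A0)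
    then show ?thesis by (metis add_left_cancel mult_cancel_right mult_zero_right zero_neq_one add.right_neutral)
  qed (simp add: B0)
  have "1 + s * s' + t * t' = 0 \<longleftrightarrow> 1 + A s 0 * A s' 0 + B 0 t * B 0 t' = 0" for s t s' t'
    using AB[of s s' t t'] A_eq[of s t] A_eq[of s' t'] B_eq[of s t] B_eq[of s' t'] by simp
  from orthogonality_coordinates[of "\<lambda>s. A s 0" "B 0", OF this A0 B0]
  have "\<bar>A s 0\<bar> = \<bar>s\<bar>" .
  moreover have "T (v s 0) \<bullet> \<psi> e2 = A s 0 * (T (v s 0) \<bullet> \<psi> e1)"
    using c0[of s 0] by (simp add: A_def c_def)
  ultimately show ?thesis by (simp add: abs_mult T_def v_def)
qed

text \<open>As \<open>- x\<close> is orthogonal to \<open>e\<close> and \<open>f\<close>, its image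
  can only be a multiple of \<open>\<psi> x\<close>, and the factor has absolute value
  \<open>1\<close>.\<close>

lemma image_minus:
  assumes "norm x = 1"
  obtains "\<psi> (- x) = \<psi> x" | "\<psi> (- x) = - \<psi> x"
proof -
  obtain e f where ef: "norm e = 1" "norm f = 1" "x \<bullet> e = 0" "x \<bullet> f = 0" "e \<bullet> f = 0"
    using exists_frame[OF dim assms] by blast
  define k where "k = \<psi> (- x) \<bullet> \<psi> x"
  have 0: "\<psi> (- x) \<bullet> \<psi> e = 0" "\<psi> (- x) \<bullet> \<psi> f = 0" using assms ef by (simp_all add: orth_iff)
  have "norm (- x) = 1" "- x = (- 1) *\<^sub>R x + 0 *\<^sub>R e + 0 *\<^sub>R f" using assms by simp_all
  note image_in_span[OF assms ef(1-5) this, unfolded 0 scaleR_zero_left add_0_right, folded k_def]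
  then have k: "\<psi> (- x) = k *\<^sub>R \<psi> x" .
  then have "\<bar>k\<bar> = 1" using norm_image[of "- x"] assms by simp
  then have "k = 1 \<or> k = - 1" by linarith
  then show ?thesis using that k by auto
qed

text \<open>Positivity makes \<open>y\<close> the direction of \<open>x + s *\<^sub>R e\<close>. By
  \<open>image_slope\<close> and the unit norm of \<open>\<psi> y\<close>, \<open>p\<close>
  satisfies \<open>(1 + s\<^sup>2) * p\<^sup>2 = 1\<close>, the same equation as
  \<open>d\<close>.\<close>

lemma abs_inner_image_pos:
  assumes x: "norm x = 1" and y: "norm y = 1" and pos: "0 < x \<bullet> y"
  shows "\<bar>\<psi> x \<bullet> \<psi> y\<bar> = \<bar>x \<bullet> y\<bar>"
proof -
  obtain e f k where ef: "norm e = 1" "norm f = 1" "x \<bullet> e = 0" "x \<bullet> f = 0" "e \<bullet> f = 0"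
    and frame: "y = (x \<bullet> y) *\<^sub>R x + k *\<^sub>R e"
    using exists_frame[OF dim x, of y] by blast
  define d where "d = x \<bullet> y"
  have k: "y = d *\<^sub>R x + k *\<^sub>R e" using frame by (simp only: d_def)
  have "0 < d" using pos by (simp only: d_def)
  define s where "s = k / d"
  define w where "w = x + s *\<^sub>R e"
  have yw: "y = d *\<^sub>R w" using k \<open>0 < d\<close> by (simp add: w_def s_def scaleR_add_right)
  then have "sgn y = sgn w" using sgn_scaleR[of d w] \<open>0 < d\<close> by simp
  then have "sgn w = y" using y by (simp add: sgn_div_norm)
  have image: "\<psi> y = (\<psi> y \<bullet> \<psi> x) *\<^sub>R \<psi> x + (\<psi> y \<bullet> \<psi> e) *\<^sub>R \<psi> e"
  proof -
    have "y \<bullet> f = 0" using ef by (simp add: k inner_simps)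
    then have "\<psi> y \<bullet> \<psi> f = 0" using y ef by (simp add: orth_iff)
    moreover have "y = d *\<^sub>R x + k *\<^sub>R e + 0 *\<^sub>R f" using k by simp
    note image_in_span[OF x ef(1-5) y this]
    ultimately show ?thesis by (metis add.right_neutral scaleR_zero_left)
  qed
  define p q where "p = \<psi> y \<bullet> \<psi> x" and "q = \<psi> y \<bullet> \<psi> e"
  have "\<psi> y \<bullet> \<psi> y = p\<^sup>2 + q\<^sup>2"
    by (subst (2) image) (simp add: inner_simps p_def q_def power2_eq_square)
  moreover have "\<psi> y \<bullet> \<psi> y = 1" using y by (simp flip: norm_1_iff)
  ultimately have "p\<^sup>2 + q\<^sup>2 = 1" by simp
  moreover have "\<bar>q\<bar> = \<bar>s\<bar> * \<bar>p\<bar>"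
    using image_slope[OF x ef(1-5), of s] \<open>sgn w = y\<close> by (simp add: p_def q_def w_def)
  then have "q\<^sup>2 = s\<^sup>2 * p\<^sup>2" by (metis power2_abs power_mult_distrib)
  ultimately have "(1 + s\<^sup>2) * p\<^sup>2 = 1" by (simp add: algebra_simps)
  moreover have "w \<bullet> w = 1 + s\<^sup>2"
    using x ef by (simp add: w_def inner_simps norm_1_iff inner_commute power2_eq_square)
  then have "(1 + s\<^sup>2) * d\<^sup>2 = (d *\<^sub>R w) \<bullet> (d *\<^sub>R w)" by (simp add: power2_eq_square)
  then have "(1 + s\<^sup>2) * d\<^sup>2 = 1"
    using y unfolding norm_1_iff by (simp only: flip: yw)
  moreover have "1 + s\<^sup>2 \<noteq> 0" by (metis add_pos_nonneg less_irrefl zero_le_power2 zero_less_one)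
  ultimately have "p\<^sup>2 = d\<^sup>2" by (metis mult_left_cancel)
  then have "\<bar>p\<bar> = \<bar>d\<bar>" by (simp only: power2_eq_iff abs_eq_iff)
  then show ?thesis by (simp add: p_def d_def inner_commute)
qed

lemma abs_inner_image:
  assumes x: "norm x = 1" and y: "norm y = 1"
  shows "\<bar>\<psi> x \<bullet> \<psi> y\<bar> = \<bar>x \<bullet> y\<bar>"
proof -
  consider "x \<bullet> y = 0" | "0 < x \<bullet> y" | "0 < x \<bullet> (- y)" by fastforce
  then show ?thesis
  proof cases
    case 1
    then show ?thesis using orth_iff x y by simp
  next
    case 2
    then show ?thesis using abs_inner_image_pos x y by blast
  next
    case 3
    then have "\<bar>\<psi> x \<bullet> \<psi> (- y)\<bar> = \<bar>x \<bullet> (- y)\<bar>" using x y by (intro abs_inner_image_pos) auto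
    then show ?thesis using image_minus[OF y] by (metis abs_minus_cancel inner_minus_right)
  qed
qed

end

end

section \<open>Preserved radii\<close>

context sphere_bijection
begin

lemma image_eq_iff: "norm x = 1 \<Longrightarrow> norm y = 1 \<Longrightarrow> \<psi> x = \<psi> y \<longleftrightarrow> x = y"
  using bij by (auto simp: bij_betw_def inj_on_def)

lemma bex_image_cong:
  assumes "\<And>z. norm z = 1 \<Longrightarrow> Q z \<longleftrightarrow> Q' (\<psi> z)"
  shows "(\<exists>z\<in>sphere 0 1. Q z) \<longleftrightarrow> (\<exists>z\<in>sphere 0 1. Q' z)"
  by (subst (2) bex_sphere_image) (use assms in auto)

text \<open>Closed and open balls are carried along together because complements combined with
  antipodes exchange them; jointly they also determine the relation of having angle exactly
  \<open>r\<close>.\<close>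

definition preserved_radii :: "real set" where
  "preserved_radii = {r. 0 < r \<and> r < pi \<and> preserves (\<lambda>x y. sphere_angle x y \<le> r)
     \<and> preserves (\<lambda>x y. sphere_angle x y < r)}"

lemma preserved_radiiD:
  assumes "r \<in> preserved_radii"
  shows "0 < r" "r < pi" "preserves (\<lambda>x y. sphere_angle x y \<le> r)"
    "preserves (\<lambda>x y. sphere_angle x y < r)"
  using assms by (auto simp: preserved_radii_def)

lemma preserved_radiusI:
  assumes "0 < r" "r < pi"
    and "preserves U" "\<And>x y. norm x = 1 \<Longrightarrow> norm y = 1 \<Longrightarrow> U x y \<longleftrightarrow> sphere_angle x y \<le> r"
    and "preserves V" "\<And>x y. norm x = 1 \<Longrightarrow> norm y = 1 \<Longrightarrow> V x y \<longleftrightarrow> sphere_angle x y < r"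
  shows "r \<in> preserved_radii"
  using assms preserves_cong[of U] preserves_cong[of V] by (simp add: preserved_radii_def)

lemma inner_image_iff:
  assumes "r \<in> preserved_radii" "norm x = 1" "norm y = 1"
  shows "cos r \<le> \<psi> x \<bullet> \<psi> y \<longleftrightarrow> cos r \<le> x \<bullet> y"
    and "cos r < \<psi> x \<bullet> \<psi> y \<longleftrightarrow> cos r < x \<bullet> y"
    and "\<psi> x \<bullet> \<psi> y = cos r \<longleftrightarrow> x \<bullet> y = cos r"
proof -
  note r = preserved_radiiD[OF assms(1)]
  show 1: "cos r \<le> \<psi> x \<bullet> \<psi> y \<longleftrightarrow> cos r \<le> x \<bullet> y"
    using preservesD[OF r(3) assms(2,3)] sphere_angle_le_iff[of x y r]
      sphere_angle_le_iff[of "\<psi> x" "\<psi> y" r] r(1,2) assms by simp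
  show 2: "cos r < \<psi> x \<bullet> \<psi> y \<longleftrightarrow> cos r < x \<bullet> y"
    using preservesD[OF r(4) assms(2,3)] sphere_angle_less_iff[of x y r]
      sphere_angle_less_iff[of "\<psi> x" "\<psi> y" r] r(1,2) assms by simp
  show "\<psi> x \<bullet> \<psi> y = cos r \<longleftrightarrow> x \<bullet> y = cos r" using 1 2 by linarith
qed

section \<open>Arithmetic of preserved radii\<close>

lemma preserved_radius_add:
  assumes r: "r \<in> preserved_radii" and s: "s \<in> preserved_radii" and "r + s < pi"
  shows "r + s \<in> preserved_radii"
proof (rule preserved_radiusI)
  note r = preserved_radiiD[OF r] and s = preserved_radiiD[OF s]
  show "0 < r + s" "r + s < pi" using r(1) s(1) assms(3) by auto
  show "preserves (\<lambda>x y. \<exists>z\<in>sphere 0 1. sphere_angle x z \<le> r \<and> sphere_angle z y \<le> s)"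
    "preserves (\<lambda>x y. \<exists>z\<in>sphere 0 1. sphere_angle x z < r \<and> sphere_angle z y < s)"
    using preserves_comp r(3,4) s(3,4) by blast+
qed (use preserved_radiiD(1)[OF r] preserved_radiiD(1)[OF s] dim in \<open>simp_all add: two_step_le two_step_less\<close>)

text \<open>The \<open>(r - s)\<close>-ball around \<open>y\<close> consists of the points
  \<open>x\<close> whose closed \<open>s\<close>-ball stays inside the \<open>r\<close>-ball around
  \<open>y\<close>. A point \<open>z\<close> leaving the latter is close to \<open>- y\<close>, so
  failure is a two-step problem from \<open>x\<close> to \<open>- y\<close>.\<close>

lemma preserved_radius_diff:
  assumes r: "r \<in> preserved_radii" and s: "s \<in> preserved_radii" and "s < r"
  shows "r - s \<in> preserved_radii"
proof (rule preserved_radiusI)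
  note r = preserved_radiiD[OF r] and s = preserved_radiiD[OF s]
  show "0 < r - s" "r - s < pi" using r(2) s(1) assms(3) by auto
  show "preserves (\<lambda>x y. \<not> (\<exists>z\<in>sphere 0 1. sphere_angle x z \<le> s \<and> \<not> sphere_angle z y \<le> r))"
    "preserves (\<lambda>x y. \<not> (\<exists>z\<in>sphere 0 1. sphere_angle x z \<le> s \<and> \<not> sphere_angle z y < r))"
    by (intro preserves_not preserves_comp r s)+
  fix x y :: 'a
  assume x: "norm x = 1" and y: "norm y = 1"
  have "(\<exists>z\<in>sphere 0 1. sphere_angle x z \<le> s \<and> \<not> sphere_angle z y \<le> r)
      \<longleftrightarrow> (\<exists>z\<in>sphere 0 1. sphere_angle x z \<le> s \<and> sphere_angle z (- y) < pi - r)"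
    using y by (intro bex_cong) auto
  also have "\<dots> \<longleftrightarrow> sphere_angle x (- y) < s + (pi - r)"
    using two_step_le_less[OF dim x, of "- y" s "pi - r"] y r(2) s(1) by simp
  finally show "\<not> (\<exists>z\<in>sphere 0 1. sphere_angle x z \<le> s \<and> \<not> sphere_angle z y \<le> r)
      \<longleftrightarrow> sphere_angle x y \<le> r - s"
    using x y by auto
  have "(\<exists>z\<in>sphere 0 1. sphere_angle x z \<le> s \<and> \<not> sphere_angle z y < r)
      \<longleftrightarrow> (\<exists>z\<in>sphere 0 1. sphere_angle x z \<le> s \<and> sphere_angle z (- y) \<le> pi - r)"
    using y by (intro bex_cong) auto
  also have "\<dots> \<longleftrightarrow> sphere_angle x (- y) \<le> s + (pi - r)"
    using two_step_le[OF dim x, of "- y" s "pi - r"] y r(2) s(1) by simp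
  finally show "\<not> (\<exists>z\<in>sphere 0 1. sphere_angle x z \<le> s \<and> \<not> sphere_angle z y < r)
      \<longleftrightarrow> sphere_angle x y < r - s"
    using x y by auto
qed

lemma bex_sphere_minus: "(\<exists>z\<in>sphere 0 1. Q z) \<longleftrightarrow> (\<exists>z\<in>sphere (0::'b::real_normed_vector) 1. Q (- z))"
  by (metis (no_types, lifting) dist_0_norm mem_sphere minus_minus norm_minus_cancel)

text \<open>Replacing \<open>z\<close> by \<open>- z\<close> turns two angles of at least
  \<open>r\<close> into two steps of at most \<open>pi - r\<close>.\<close>

lemma preserved_radius_fold:
  assumes r: "r \<in> preserved_radii" and "pi / 2 < r"
  shows "2 * pi - 2 * r \<in> preserved_radii"
proof (rule preserved_radiusI)
  note r = preserved_radiiD[OF r]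
  show "0 < 2 * pi - 2 * r" "2 * pi - 2 * r < pi" using r(2) assms(2) by auto
  show "preserves (\<lambda>x y. \<exists>z\<in>sphere 0 1. \<not> sphere_angle x z < r \<and> \<not> sphere_angle z y < r)"
    "preserves (\<lambda>x y. \<exists>z\<in>sphere 0 1. \<not> sphere_angle x z \<le> r \<and> \<not> sphere_angle z y \<le> r)"
    by (intro preserves_not preserves_comp r)+
  fix x y :: 'a
  assume x: "norm x = 1" and y: "norm y = 1"
  have "(\<exists>z\<in>sphere 0 1. \<not> sphere_angle x z < r \<and> \<not> sphere_angle z y < r)
      \<longleftrightarrow> (\<exists>z\<in>sphere 0 1. sphere_angle x z \<le> pi - r \<and> sphere_angle z y \<le> pi - r)"
    using x y by (subst bex_sphere_minus, intro bex_cong) auto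
  then show "(\<exists>z\<in>sphere 0 1. \<not> sphere_angle x z < r \<and> \<not> sphere_angle z y < r)
      \<longleftrightarrow> sphere_angle x y \<le> 2 * pi - 2 * r"
    using two_step_le[OF dim x y, of "pi - r" "pi - r"] r(2) by simp
  have "(\<exists>z\<in>sphere 0 1. \<not> sphere_angle x z \<le> r \<and> \<not> sphere_angle z y \<le> r)
      \<longleftrightarrow> (\<exists>z\<in>sphere 0 1. sphere_angle x z < pi - r \<and> sphere_angle z y < pi - r)"
    using x y by (subst bex_sphere_minus, intro bex_cong) auto
  then show "(\<exists>z\<in>sphere 0 1. \<not> sphere_angle x z \<le> r \<and> \<not> sphere_angle z y \<le> r)
      \<longleftrightarrow> sphere_angle x y < 2 * pi - 2 * r"
    using two_step_less[OF dim x y, of "pi - r" "pi - r"] r(2) by simp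
qed

lemma preserved_radius_arccosI:
  assumes k: "- 1 < k" "k < 1"
    and "preserves U" "\<And>x y. norm x = 1 \<Longrightarrow> norm y = 1 \<Longrightarrow> U x y \<longleftrightarrow> k \<le> x \<bullet> y"
    and "preserves V" "\<And>x y. norm x = 1 \<Longrightarrow> norm y = 1 \<Longrightarrow> V x y \<longleftrightarrow> k < x \<bullet> y"
  shows "arccos k \<in> preserved_radii"
proof (rule preserved_radiusI[OF _ _ assms(3) _ assms(5)])
  show "0 < arccos k" "arccos k < pi" using arccos_lt_bounded[of k] k by auto
qed (use assms arccos_lbound[of k] arccos_ubound[of k] in \<open>simp_all add: sphere_angle_le_iff sphere_angle_less_iff\<close>)

section \<open>Preserved radii obtained from configurations\<close>

text \<open>The passage from an exact angle to balls: one common neighbour describes the closed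
  ball, two distinct ones the open ball. If \<open>c = cos \<alpha>\<close>, the threshold is
  \<open>cos (2 * \<alpha>)\<close>.\<close>

lemma preserved_radius_doubled:
  assumes c: "preserves (\<lambda>x y. x \<bullet> y = c)" "c \<noteq> 0" "\<bar>c\<bar> < 1"
  shows "arccos (2 * c\<^sup>2 - 1) \<in> preserved_radii"
proof (rule preserved_radius_arccosI)
  have "0 < c\<^sup>2" "c\<^sup>2 < 1" using c by (simp_all add: abs_square_less_1)
  then show "- 1 < 2 * c\<^sup>2 - 1" "2 * c\<^sup>2 - 1 < 1" by simp_all
  show "preserves (\<lambda>x y. \<exists>z\<in>sphere 0 1. x \<bullet> z = c \<and> z \<bullet> y = c)"
    by (intro preserves_comp c)
  show "preserves (\<lambda>x y. \<exists>z\<in>sphere 0 1. \<exists>z'\<in>sphere 0 1. z \<noteq> z' \<and>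
      x \<bullet> z = c \<and> z \<bullet> y = c \<and> x \<bullet> z' = c \<and> z' \<bullet> y = c)"
    unfolding preserves_def
    by (intro ballI bex_image_cong) (simp add: image_eq_iff preservesD[OF c(1)])
  fix x y :: 'a
  assume x: "norm x = 1" and y: "norm y = 1"
  note ex = common_neighbour_exists[OF dim x y c(2)]
  show "(\<exists>z\<in>sphere 0 1. x \<bullet> z = c \<and> z \<bullet> y = c) \<longleftrightarrow> 2 * c\<^sup>2 - 1 \<le> x \<bullet> y"
    using common_neighbour_bound(1)[OF x y] by (auto elim!: ex)
  show "(\<exists>z\<in>sphere 0 1. \<exists>z'\<in>sphere 0 1. z \<noteq> z' \<and>
      x \<bullet> z = c \<and> z \<bullet> y = c \<and> x \<bullet> z' = c \<and> z' \<bullet> y = c) \<longleftrightarrow> 2 * c\<^sup>2 - 1 < x \<bullet> y" (is "?L \<longleftrightarrow> ?R")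
  proof
    assume ?L
    then obtain z z' where z: "norm z = 1" "norm z' = 1" "z \<noteq> z'"
      "x \<bullet> z = c" "z \<bullet> y = c" "x \<bullet> z' = c" "z' \<bullet> y = c" by auto
    have "x \<bullet> y \<noteq> 2 * c\<^sup>2 - 1"
      using common_neighbour_bound(2)[OF x y z(1,4,5)] common_neighbour_bound(2)[OF x y z(2,6,7)] z(3) c(2)
      by (metis mult_eq_0_iff scaleR_left_imp_eq zero_neq_numeral)
    then show ?R using common_neighbour_bound(1)[OF x y z(1,4,5)] by simp
  next
    assume ?R
    then have "2 * c\<^sup>2 - 1 \<le> x \<bullet> y" by simp
    from ex[OF this] obtain z z' where "norm z = 1" "norm z' = 1" "x \<bullet> z = c" "z \<bullet> y = c"
      "x \<bullet> z' = c" "z' \<bullet> y = c" "2 * c\<^sup>2 - 1 < x \<bullet> y \<Longrightarrow> z \<noteq> z'" by metis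
    then show ?L using \<open>?R\<close> by (intro bexI[of _ z] bexI[of _ z']) auto
  qed
qed

lemma preserved_radius_rhombus:
  assumes r: "r \<in> preserved_radii" "r < pi / 2"
  obtains g where "g \<in> preserved_radii" "r < g" "g < 2 * r"
proof -
  define C where "C = cos r"
  note r0 = preserved_radiiD(1,2)[OF r(1)]
  have C: "0 < C" "C < 1" using r0 r(2) cos_gt_zero[of r] cos_monotone_0_pi[of 0 r] by (simp_all add: C_def)
  define k where "k = 4 * C\<^sup>2 / (1 + C) - 1"
  \<comment> \<open>\<open>k < C\<close> says that the long diagonal exceeds \<open>r\<close>, and
    \<open>2 * C\<^sup>2 - 1 < k\<close> that it stays below \<open>2 * r\<close>.\<close>
  have k: "- 1 < k" "k < C" "2 * C\<^sup>2 - 1 < k"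
  proof -
    show "- 1 < k" using C by (simp add: k_def)
    have "4 * C\<^sup>2 < (1 + C) * (1 + C)"
      using mult_strict_mono[of "2 * C" "1 + C" "2 * C" "1 + C"] C by (simp add: power2_eq_square)
    then show "k < C" using C by (simp add: k_def field_simps)
    have "2 * C\<^sup>2 * (1 + C) < 2 * C\<^sup>2 * 2" using C by (intro mult_strict_left_mono) auto
    then show "2 * C\<^sup>2 - 1 < k" using C by (simp add: k_def field_simps)
  qed
  \<comment> \<open>Only comparisons with \<open>cos r\<close> occur, and these are preserved. In
    \<open>?V\<close> just the sides become strict; the short diagonal keeps its closed
    condition.\<close>
  let ?U = "\<lambda>z w x y. x \<bullet> y \<le> C \<and> C \<le> x \<bullet> z \<and> C \<le> y \<bullet> z \<and> C \<le> x \<bullet> w \<and> C \<le> y \<bullet> w"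
  let ?V = "\<lambda>z w x y. x \<bullet> y \<le> C \<and> C < x \<bullet> z \<and> C < y \<bullet> z \<and> C < x \<bullet> w \<and> C < y \<bullet> w"
  note iff = inner_image_iff(1,2)[OF r(1), folded C_def]
  have iff': "\<psi> x \<bullet> \<psi> y \<le> C \<longleftrightarrow> x \<bullet> y \<le> C" if "norm x = 1" "norm y = 1" for x y
    using iff(2)[OF that] by linarith
  have "arccos k \<in> preserved_radii"
  proof (rule preserved_radius_arccosI)
    show "- 1 < k" "k < 1" using k C by auto
    show "preserves (\<lambda>z w. \<exists>x\<in>sphere 0 1. \<exists>y\<in>sphere 0 1. ?U z w x y)"
      "preserves (\<lambda>z w. \<exists>x\<in>sphere 0 1. \<exists>y\<in>sphere 0 1. ?V z w x y)"
      unfolding preserves_def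
      by (intro ballI bex_image_cong; simp add: iff iff')+
    fix z w :: 'a
    assume z: "norm z = 1" and w: "norm w = 1"
    show "(\<exists>x\<in>sphere 0 1. \<exists>y\<in>sphere 0 1. ?U z w x y) \<longleftrightarrow> k \<le> z \<bullet> w" (is "?L \<longleftrightarrow> ?R")
    proof
      assume ?L
      then show ?R using rhombus_bound(1)[OF _ _ z w C(1)] by (auto simp: k_def)
    next
      assume ?R
      then show ?L unfolding k_def by (rule rhombus_exists[OF dim z w C]) force
    qed
    show "(\<exists>x\<in>sphere 0 1. \<exists>y\<in>sphere 0 1. ?V z w x y) \<longleftrightarrow> k < z \<bullet> w" (is "?L \<longleftrightarrow> ?R")
    proof
      assume ?L
      then show ?R using rhombus_bound(2)[OF _ _ z w C(1)] by (auto simp: k_def)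
    next
      assume "?R"
      then have "k \<le> z \<bullet> w" by simp
      then show ?L using \<open>?R\<close> unfolding k_def by (rule_tac rhombus_exists[OF dim z w C]) force+
    qed
  qed
  moreover have "arccos C < arccos k" using k C by (intro arccos_less_arccos) auto
  then have "r < arccos k" using r0 by (simp add: C_def arccos_cos)
  moreover have "2 * C\<^sup>2 - 1 = cos (2 * r)" by (simp add: C_def cos_double_cos)
  then have "arccos k < arccos (cos (2 * r))" using k C by (intro arccos_less_arccos) auto
  then have "arccos k < 2 * r" using r0 r(2) by (simp add: arccos_cos)
  ultimately show ?thesis using that by blast
qed

text \<open>Every condition of the configuration compares an inner product with
  \<open>cos (2 * pi / 3) = - 1/2\<close>, and such a configuration over \<open>x\<close> and
  \<open>y\<close> exists precisely down to \<open>x \<bullet> y = - 1/3\<close>.\<close>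

lemma preserved_radius_third:
  assumes r: "2 * pi / 3 \<in> preserved_radii"
  shows "arccos (- 1/3) \<in> preserved_radii"
proof (rule preserved_radius_arccosI)
  note iff = inner_image_iff[OF r, unfolded cos_120]
  have iff': "\<psi> x \<bullet> \<psi> y \<le> - 1/2 \<longleftrightarrow> x \<bullet> y \<le> - 1/2" "\<psi> x \<bullet> \<psi> y < - 1/2 \<longleftrightarrow> x \<bullet> y < - 1/2"
    if "norm x = 1" "norm y = 1" for x y using iff(1,2)[OF that] by linarith+
  let ?N = "\<lambda>x y z z' a b. z \<bullet> x = - 1/2 \<and> z \<bullet> y = - 1/2 \<and> z' \<bullet> x = - 1/2 \<and> z' \<bullet> y = - 1/2 \<and>
    a \<bullet> x = - 1/2 \<and> a \<bullet> z = - 1/2 \<and> b \<bullet> y = - 1/2 \<and> b \<bullet> z = - 1/2"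
  let ?U = "\<lambda>x y. \<exists>z\<in>sphere 0 1. \<exists>z'\<in>sphere 0 1. \<exists>a\<in>sphere 0 1. \<exists>b\<in>sphere 0 1. \<exists>q\<in>sphere 0 1.
    ?N x y z z' a b \<and> q \<bullet> z' \<le> - 1/2 \<and> q \<bullet> a \<le> - 1/2 \<and> q \<bullet> b \<le> - 1/2"
  let ?V = "\<lambda>x y. \<exists>z\<in>sphere 0 1. \<exists>z'\<in>sphere 0 1. \<exists>a\<in>sphere 0 1. \<exists>b\<in>sphere 0 1. \<exists>q\<in>sphere 0 1.
    ?N x y z z' a b \<and> q \<bullet> z' < - 1/2 \<and> q \<bullet> a < - 1/2 \<and> q \<bullet> b < - 1/2"
  show "- 1 < (- 1/3::real)" "(- 1/3::real) < 1" by simp_all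
  show "preserves ?U" "preserves ?V"
    unfolding preserves_def
    by (intro ballI bex_image_cong; simp only: mem_sphere_0 iff iff')+
  fix x y :: 'a
  assume x: "norm x = 1" and y: "norm y = 1"
  show "?U x y \<longleftrightarrow> - 1/3 \<le> x \<bullet> y"
  proof
    assume "?U x y"
    then show "- 1/3 \<le> x \<bullet> y" using third_bound(1)[OF x y] by force
  next
    assume "- 1/3 \<le> x \<bullet> y"
    then show "?U x y" by (rule third_exists[OF dim x y]) force
  qed
  show "?V x y \<longleftrightarrow> - 1/3 < x \<bullet> y"
  proof
    assume "?V x y"
    then show "- 1/3 < x \<bullet> y" using third_bound(2)[OF x y] by force
  next
    assume *: "- 1/3 < x \<bullet> y"
    then have "- 1/3 \<le> x \<bullet> y" by simp
    then show "?V x y" using * by (rule_tac third_exists[OF dim x y]) force+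
  qed
qed

section \<open>Small radii and density\<close>

lemma arbitrarily_small_preserved_radius:
  assumes r: "r \<in> preserved_radii" "r < pi / 2" and "0 < \<epsilon>"
  obtains s where "s \<in> preserved_radii" "s < \<epsilon>"
proof -
  define i where "i = Inf preserved_radii"
  have bdd: "bdd_below preserved_radii"
    using preserved_radiiD(1) by (intro bdd_belowI[of _ 0]) force
  have lower: "i \<le> s" if "s \<in> preserved_radii" for s
    unfolding i_def using that bdd by (rule cInf_lower)
  have "i < \<epsilon>"
  proof (rule ccontr)
    assume "\<not> i < \<epsilon>"
    then have "0 < i" using \<open>0 < \<epsilon>\<close> by simp
    obtain s where s: "s \<in> preserved_radii" "s < 2 * i"
      using cInf_lessD[of preserved_radii "2 * i"] r(1) \<open>0 < i\<close> by (auto simp: i_def)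
    \<comment> \<open>If the infimum were not attained, two distinct radii would lie between
      \<open>i\<close> and \<open>2 * i\<close>, and their difference would be a preserved radius
      below \<open>i\<close>.\<close>
    have "i \<in> preserved_radii"
    proof (rule ccontr)
      assume "i \<notin> preserved_radii"
      then have "i < s" using lower[OF s(1)] s(1) by (cases "i = s") auto
      then obtain t where t: "t \<in> preserved_radii" "t < s"
        using cInf_lessD[of preserved_radii s] r(1) by (auto simp: i_def)
      then have "i \<le> s - t" using preserved_radius_diff[OF s(1)] lower by blast
      then show False using lower[OF t(1)] s(2) by simp
    qed
    moreover have "i < pi / 2" using lower[OF r(1)] r(2) by simp
    \<comment> \<open>Now the rhombus over \<open>i\<close> itself gives a radius \<open>g\<close>
      with \<open>g - i < i\<close>, again too small.\<close>
    ultimately obtain g where g: "g \<in> preserved_radii" "i < g" "g < 2 * i"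
      by (rule preserved_radius_rhombus)
    then have "i \<le> g - i" using preserved_radius_diff \<open>i \<in> preserved_radii\<close> lower by blast
    then show False using g(3) by simp
  qed
  then show ?thesis
    using cInf_lessD[of preserved_radii \<epsilon>] r(1) that by (auto simp: i_def)
qed

lemma preserved_radii_dense:
  assumes r: "r \<in> preserved_radii" "r < pi / 2" and ab: "0 \<le> a" "a < b" "b \<le> pi"
  obtains s where "s \<in> preserved_radii" "a < s" "s < b"
proof -
  obtain t where t: "t \<in> preserved_radii" "t < b - a"
    using arbitrarily_small_preserved_radius[OF r, of "b - a"] ab by auto
  have "0 < t" using preserved_radiiD(1)[OF t(1)] .
  \<comment> \<open>\<open>Suc n\<close> keeps the multiples positive, as \<open>0\<close> does not
    count as a preserved radius.\<close>
  have mult: "real (Suc n) * t \<in> preserved_radii" if "real (Suc n) * t < pi" for n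
    using that
  proof (induction n)
    case (Suc n)
    then have "real (Suc n) * t \<in> preserved_radii" using \<open>0 < t\<close> by (simp add: algebra_simps)
    from preserved_radius_add[OF this t(1)] Suc.prems show ?case by (simp add: algebra_simps)
  qed (simp add: t)
  \<comment> \<open>\<open>real (Suc n) * t\<close> is the first multiple beyond \<open>a\<close>;
    it overshoots by at most \<open>t\<close>, which is less than \<open>b - a\<close>.\<close>
  define n where "n = nat \<lfloor>a / t\<rfloor>"
  have "real n \<le> a / t" "a / t < real n + 1"
    using ab(1) \<open>0 < t\<close> by (auto simp: n_def)
  then have n: "real n * t \<le> a" "a < real (Suc n) * t" using \<open>0 < t\<close> by (simp_all add: field_simps)
  then have "real (Suc n) * t < b" using t(2) by (simp add: algebra_simps)
  then show ?thesis using n(2) ab(3) mult by (intro that) auto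
qed

lemma inner_image_eq_of_radius:
  assumes r: "r \<in> preserved_radii" "r < pi / 2" and x: "norm x = 1" and y: "norm y = 1"
  shows "\<psi> x \<bullet> \<psi> y = x \<bullet> y"
proof -
  define a b where "a = sphere_angle x y" and "b = sphere_angle (\<psi> x) (\<psi> y)"
  have ab: "0 \<le> a" "a \<le> pi" "0 \<le> b" "b \<le> pi"
    using x y by (auto simp: a_def b_def sphere_angle_bounds)
  have iff: "b \<le> s \<longleftrightarrow> a \<le> s" if "s \<in> preserved_radii" for s
    using preservesD[OF preserved_radiiD(3)[OF that] x y] by (simp add: a_def b_def)
  have "a = b"
  proof (rule ccontr)
    assume "a \<noteq> b"
    then consider "a < b" | "b < a" by linarith
    then show False
    proof cases
      case 1
      then obtain s where "s \<in> preserved_radii" "a < s" "s < b"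
        using preserved_radii_dense[OF r ab(1) _ ab(4)] by blast
      then show False using iff by force
    next
      case 2
      then obtain s where "s \<in> preserved_radii" "b < s" "s < a"
        using preserved_radii_dense[OF r ab(3) _ ab(2)] by blast
      then show False using iff by force
    qed
  qed
  then show ?thesis
    using cos_sphere_angle[OF x y] cos_sphere_angle[of "\<psi> x" "\<psi> y"] x y by (simp add: a_def b_def)
qed

text \<open>Preserved orthogonality yields the absolute values, and the closed hemisphere relation
  supplies the signs. The rhombus only handles radii strictly below \<open>pi / 2\<close>.\<close>

lemma inner_image_eq_of_half_pi:
  assumes r: "pi / 2 \<in> preserved_radii" and x: "norm x = 1" and y: "norm y = 1"
  shows "\<psi> x \<bullet> \<psi> y = x \<bullet> y"
proof -
  note iff = inner_image_iff[OF r, unfolded cos_pi_half]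
  have "preserves (\<lambda>x y. x \<bullet> y = 0)" by (auto simp: preserves_def iff)
  then have "\<bar>\<psi> x \<bullet> \<psi> y\<bar> = \<bar>x \<bullet> y\<bar>" using abs_inner_image x y by blast
  then show ?thesis using iff(1)[OF x y] by linarith
qed

lemma exists_preserved_radius:
  assumes c: "preserves (\<lambda>x y. x \<bullet> y = c)" "c \<noteq> 0" "\<bar>c\<bar> < 1"
  obtains r where "r \<in> preserved_radii" "r \<le> pi / 2"
proof -
  define t where "t = arccos (2 * c\<^sup>2 - 1)"
  define u where "u = 2 * pi - 2 * t"
  have t: "t \<in> preserved_radii" unfolding t_def using c by (rule preserved_radius_doubled)
  note t' = preserved_radiiD(1,2)[OF t]
  show ?thesis
  proof (cases "t \<le> pi / 2 \<or> u \<le> pi / 2")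
    case True
    then show ?thesis
      using that t preserved_radius_fold[OF t] by (cases "t \<le> pi / 2") (auto simp: u_def)
  next
    case False
    then have u: "u \<in> preserved_radii" using preserved_radius_fold[OF t] by (simp add: u_def)
    note u' = preserved_radiiD(1,2)[OF u]
    \<comment> \<open>Both radii lie between \<open>pi / 2\<close> and \<open>pi\<close>, so a
      nonzero difference is below \<open>pi / 2\<close>.\<close>
    consider "u < t" | "t < u" | "t = u" by linarith
    then show ?thesis
    proof cases
      case 1
      show ?thesis by (rule that[OF preserved_radius_diff[OF t u 1]]) (use False t' u' in linarith)
    next
      case 2
      show ?thesis by (rule that[OF preserved_radius_diff[OF u t 2]]) (use False t' u' in linarith)
    next
      case 3
      then have t_eq: "t = 2 * pi / 3" by (simp add: u_def)
      \<comment> \<open>This radius lies strictly between \<open>pi / 2\<close> and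
        \<open>t\<close>, so \<open>t - w\<close> is a small one.\<close>
      define w where "w = arccos (- 1/3)"
      have w: "w \<in> preserved_radii"
        unfolding w_def using t by (intro preserved_radius_third) (simp add: t_eq)
      have "arccos (- 1/3) < arccos (- 1/2)" by (intro arccos_less_arccos) auto
      also have "arccos (- 1/2) = arccos (cos t)" unfolding t_eq cos_120 by simp
      finally have "w < t" using t' by (simp add: w_def arccos_cos)
      moreover have "arccos 0 < arccos (- 1/3)" by (intro arccos_less_arccos) auto
      then have "pi / 2 < w" by (simp add: w_def)
      ultimately show ?thesis
        using that[OF preserved_radius_diff[OF t w]] t' by simp
    qed
  qed
qed

lemma inner_image_eq:
  assumes "preserves (\<lambda>x y. x \<bullet> y = c)" "c \<noteq> 0" "\<bar>c\<bar> < 1" and x: "norm x = 1" and y: "norm y = 1"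
  shows "\<psi> x \<bullet> \<psi> y = x \<bullet> y"
proof -
  obtain r where r: "r \<in> preserved_radii" "r \<le> pi / 2"
    using exists_preserved_radius[OF assms(1-3)] .
  show ?thesis
  proof (cases "r = pi / 2")
    case True
    show ?thesis by (rule inner_image_eq_of_half_pi[OF r(1)[unfolded True] x y])
  next
    case False
    then show ?thesis using inner_image_eq_of_radius[OF r(1) _ x y] r(2) by simp
  qed
qed

end

section \<open>Extension to linear isometries\<close>

context sphere_bijection
begin

text \<open>The factor \<open>norm x\<close> yields \<open>0\<close> at \<open>0\<close>, where
  \<open>\<psi> (sgn 0)\<close> is uncontrolled.\<close>

definition homogenization :: "'a \<Rightarrow> 'a" where
  "homogenization x = norm x *\<^sub>R \<psi> (sgn x)"

lemma homogenization_unit: "norm x = 1 \<Longrightarrow> homogenization x = \<psi> x"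
  by (simp add: homogenization_def sgn_div_norm)

lemma isometry_extension:
  assumes inner: "\<And>x y. norm x = 1 \<Longrightarrow> norm y = 1 \<Longrightarrow> \<psi> x \<bullet> \<psi> y = x \<bullet> y"
  shows "\<exists>R. bij_linear_isometry R \<and> (\<forall>x\<in>sphere 0 1. \<psi> x = R x)"
proof (intro exI[of _ homogenization] conjI bij_linear_isometry_of_inner_preserving ballI)
  fix x y :: 'a
  show "homogenization x \<bullet> homogenization y = x \<bullet> y"
  proof (cases "x = 0 \<or> y = 0")
    case False
    then have "\<psi> (sgn x) \<bullet> \<psi> (sgn y) = sgn x \<bullet> sgn y" by (intro inner) (auto simp: norm_sgn)
    then show ?thesis using inner_eq_norm_sgn[of x y] by (simp add: homogenization_def)
  qed (auto simp: homogenization_def)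
next
  fix y :: 'a
  assume "norm y = 1"
  then obtain x where "norm x = 1" "y = \<psi> x" by (rule ex_preimage)
  then show "\<exists>x. homogenization x = y" using homogenization_unit by metis
qed (simp add: homogenization_unit)

text \<open>Fix a unit \<open>e\<close>. For \<open>x\<close> orthogonal to \<open>e\<close>, the
  sign \<open>\<sigma> x\<close> normalises \<open>T (e + x)\<close> to have component
  \<open>1\<close> along \<open>T e\<close>; the remainder \<open>S x\<close> preserves inner
  products exactly, and together with \<open>T e\<close> it assembles to \<open>R\<close>.\<close>

lemma wigner_extension:
  assumes abs_inner: "\<And>x y. norm x = 1 \<Longrightarrow> norm y = 1 \<Longrightarrow> \<bar>\<psi> x \<bullet> \<psi> y\<bar> = \<bar>x \<bullet> y\<bar>"
  shows "\<exists>R. bij_linear_isometry R \<and> (\<forall>x\<in>sphere 0 1. \<psi> x \<in> {- R x, R x})"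
proof (cases "\<exists>e::'a. norm e = 1")
  case False
  then show ?thesis
    by (intro exI[of _ id]) (auto simp: bij_linear_isometry_def linear_id[unfolded id_def[symmetric]])
next
  case True
  then obtain e :: 'a where e: "norm e = 1" by blast
  define T where "T = homogenization"
  have T: "\<bar>T x \<bullet> T y\<bar> = \<bar>x \<bullet> y\<bar>" for x y
  proof (cases "x = 0 \<or> y = 0")
    case False
    then have "\<bar>\<psi> (sgn x) \<bullet> \<psi> (sgn y)\<bar> = \<bar>sgn x \<bullet> sgn y\<bar>" by (intro abs_inner) (auto simp: norm_sgn)
    then show ?thesis
      using inner_eq_norm_sgn[of x y] by (simp add: T_def homogenization_def abs_mult)
  qed (auto simp: T_def homogenization_def)
  have TT: "T x \<bullet> T x = x \<bullet> x" for x using T[of x x] by simp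
  have ee: "e \<bullet> e = 1" "T e \<bullet> T e = 1" using e by (simp_all add: TT flip: norm_1_iff)
  define \<sigma> where "\<sigma> x = T (e + x) \<bullet> T e" for x
  define S where "S x = \<sigma> x *\<^sub>R T (e + x) - T e" for x
  have \<sigma>: "\<bar>\<sigma> x\<bar> = 1" if "x \<bullet> e = 0" for x
    using T[of "e + x" e] that by (simp add: \<sigma>_def inner_add_left ee)
  have S_e: "S x \<bullet> T e = 0" if "x \<bullet> e = 0" for x
  proof -
    have "S x \<bullet> T e = \<sigma> x * \<sigma> x - 1" by (simp add: S_def inner_diff_left ee \<sigma>_def)
    also have "\<sigma> x * \<sigma> x = 1" using \<sigma>[OF that] by (metis abs_mult_self_eq mult_1)
    finally show ?thesis by simp
  qed
  have S_eq: "\<sigma> x *\<^sub>R T (e + x) = T e + S x" for x by (simp add: S_def)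
  have T_S: "\<bar>z \<bullet> T (e + x)\<bar> = \<bar>z \<bullet> T e + z \<bullet> S x\<bar>" if "x \<bullet> e = 0" for x z
  proof -
    have "z \<bullet> T e + z \<bullet> S x = \<sigma> x * (z \<bullet> T (e + x))" by (simp add: S_def inner_diff_right)
    then show ?thesis using \<sigma>[OF that] by (simp add: abs_mult)
  qed
  have S_shift: "\<bar>1 + S x \<bullet> S y\<bar> = \<bar>1 + x \<bullet> y\<bar>" if x: "x \<bullet> e = 0" and y: "y \<bullet> e = 0" for x y
  proof -
    have "1 + S x \<bullet> S y = (\<sigma> x *\<^sub>R T (e + x)) \<bullet> (\<sigma> y *\<^sub>R T (e + y))"
      unfolding S_eq using S_e[OF x] S_e[OF y] ee by (simp add: inner_add_left inner_add_right inner_commute)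
    also have "\<bar>\<dots>\<bar> = \<bar>(e + x) \<bullet> (e + y)\<bar>" using \<sigma>[OF x] \<sigma>[OF y] T by (simp add: abs_mult)
    also have "(e + x) \<bullet> (e + y) = 1 + x \<bullet> y"
      using x y ee by (simp add: inner_add_left inner_add_right inner_commute)
    finally show ?thesis .
  qed
  have S_norm: "S x \<bullet> S x = x \<bullet> x" if "x \<bullet> e = 0" for x
    using S_shift[OF that that] inner_ge_zero[of x] inner_ge_zero[of "S x"] by linarith
  have S_T: "S x = T x \<or> S x = - T x" if "x \<bullet> e = 0" for x
  proof (rule eq_or_eq_minus)
    have "T x \<bullet> T e = 0" using T[of x e] that by simp
    then have "\<bar>T x \<bullet> S x\<bar> = \<bar>T x \<bullet> T (e + x)\<bar>" using T_S[OF that, of "T x"] by simp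
    then show "\<bar>S x \<bullet> T x\<bar> = x \<bullet> x" using T[of x "e + x"] that by (simp add: inner_add_right inner_commute)
  qed (use that in \<open>simp_all add: S_norm TT\<close>)
  have S_abs: "\<bar>z \<bullet> S x\<bar> = \<bar>z \<bullet> T x\<bar>" if "x \<bullet> e = 0" for x z
    using S_T[OF that] by auto
  have S_inner: "S x \<bullet> S y = x \<bullet> y" if x: "x \<bullet> e = 0" and y: "y \<bullet> e = 0" for x y
  proof -
    have "\<bar>S x \<bullet> S y\<bar> = \<bar>x \<bullet> y\<bar>"
      using S_abs[OF y, of "S x"] S_abs[OF x, of "T y"] T[of x y] by (simp add: inner_commute)
    \<comment> \<open>A wrong sign would give \<open>\<bar>1 - k\<bar> = \<bar>1 + k\<bar>\<close>
      for \<open>k = x \<bullet> y\<close>, hence \<open>k = 0\<close>.\<close>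
    then show ?thesis using S_shift[OF x y] by linarith
  qed
  define P where "P v = v - (v \<bullet> e) *\<^sub>R e" for v
  have P: "P v \<bullet> e = 0" for v by (simp add: P_def inner_diff_left ee)
  have P_inner: "v \<bullet> w = (v \<bullet> e) * (w \<bullet> e) + P v \<bullet> P w" for v w
    by (simp add: P_def inner_diff_left inner_diff_right ee inner_commute)
  define R where "R v = (v \<bullet> e) *\<^sub>R T e + S (P v)" for v
  have R: "R v \<bullet> R w = v \<bullet> w" for v w
    using S_e[OF P, of v] S_e[OF P, of w] S_inner[OF P P, of v w] P_inner[of v w] ee
    by (simp add: R_def inner_add_left inner_add_right inner_commute)
  have R_T: "T v = R v \<or> T v = - R v" for v
  proof (rule eq_or_eq_minus)
    define a b where "a = v \<bullet> e" and "b = P v \<bullet> P v"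
    define p q where "p = T v \<bullet> T e" and "q = T v \<bullet> S (P v)"
    have vP: "v \<bullet> P v = b" using P_inner[of v "P v"] P[of v] by (simp add: b_def P_def inner_diff_left ee)
    have "\<bar>p\<bar> = \<bar>a\<bar>" using T[of v e] by (simp add: p_def a_def)
    moreover have "\<bar>q\<bar> = \<bar>b\<bar>" using S_abs[OF P, of "T v" v] T[of v "P v"] vP by (simp add: q_def)
    moreover have "\<bar>p + q\<bar> = \<bar>a + b\<bar>"
      using T_S[OF P, of "T v" v] T[of v "e + P v"] vP by (simp add: p_def q_def a_def inner_add_right)
    \<comment> \<open>\<open>\<bar>p + q\<bar> = \<bar>a + b\<bar>\<close> forces \<open>p\<close>
      and \<open>q\<close> to differ from \<open>a\<close> and \<open>b\<close> by a common sign,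
      unless \<open>a\<close> or \<open>b\<close> is \<open>0\<close>; those cases agree as
      well.\<close>
    ultimately have "a * p + q = a * a + b \<or> a * p + q = - (a * a + b)"
      by (auto simp: abs_eq_iff)
    moreover have "T v \<bullet> R v = a * p + q" by (simp add: R_def inner_add_right p_def q_def a_def)
    moreover have "v \<bullet> v = a * a + b" using P_inner[of v v] by (simp add: a_def b_def)
    ultimately have "T v \<bullet> R v = v \<bullet> v \<or> T v \<bullet> R v = - (v \<bullet> v)" by simp
    then show "\<bar>T v \<bullet> R v\<bar> = v \<bullet> v" using inner_ge_zero[of v] by linarith
  qed (simp_all add: R TT)
  have \<psi>: "\<psi> x = R x \<or> \<psi> x = - R x" if "norm x = 1" for x
    using R_T[of x] that by (simp add: T_def homogenization_unit)
  have lin: "linear R" using R by (rule linear_of_inner_preserving)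
  have "bij_linear_isometry R"
  proof (rule bij_linear_isometry_of_inner_preserving[OF R])
    fix y :: 'a
    assume "norm y = 1"
    then obtain x where "norm x = 1" "y = \<psi> x" by (rule ex_preimage)
    then have "R x = y \<or> R (- x) = y" using \<psi>[of x] by (auto simp: linear_neg[OF lin])
    then show "\<exists>x. R x = y" by blast
  qed
  moreover have "\<psi> x \<in> {- R x, R x}" if "x \<in> sphere 0 1" for x using \<psi>[of x] that by auto
  ultimately show ?thesis by blast
qed

end

theorem theorem2:
  fixes \<psi> :: "'a::real_inner \<Rightarrow> 'a" and \<alpha> :: real
  assumes dim: "dim_at_least 3 TYPE('a)"
    and \<alpha>: "0 < \<alpha>" "\<alpha> < pi"
    and bij: "bij_betw \<psi> (sphere 0 1) (sphere 0 1)"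
    and angle: "\<And>x y. x \<in> sphere 0 1 \<Longrightarrow> y \<in> sphere 0 1 \<Longrightarrow>
      sphere_angle x y = \<alpha> \<longleftrightarrow> sphere_angle (\<psi> x) (\<psi> y) = \<alpha>"
  shows "\<exists>R :: 'a \<Rightarrow> 'a. bij_linear_isometry R \<and>
    (\<alpha> \<noteq> pi / 2 \<longrightarrow> (\<forall>x\<in>sphere 0 1. \<psi> x = R x)) \<and>
    (\<alpha> = pi / 2 \<longrightarrow> (\<forall>x\<in>sphere 0 1. \<psi> x \<in> {- R x, R x}))"
proof -
  interpret sphere_bijection \<psi> by (rule sphere_bijection.intro[OF dim bij])
  define c where "c = cos \<alpha>"
  have angle_iff: "sphere_angle x y = \<alpha> \<longleftrightarrow> x \<bullet> y = c" if "norm x = 1" "norm y = 1" for x y :: 'a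
  proof -
    have "sphere_angle x y \<le> \<alpha> \<longleftrightarrow> c \<le> x \<bullet> y" "sphere_angle x y < \<alpha> \<longleftrightarrow> c < x \<bullet> y"
      unfolding c_def using that \<alpha> by (simp_all add: sphere_angle_le_iff sphere_angle_less_iff)
    then show ?thesis by linarith
  qed
  have "preserves (\<lambda>x y. sphere_angle x y = \<alpha>)"
    unfolding preserves_def using angle by blast
  then have c: "preserves (\<lambda>x y. x \<bullet> y = c)" using angle_iff by (rule preserves_cong)
  show ?thesis
  proof (cases "\<alpha> = pi / 2")
    case True
    have "c = 0" unfolding c_def True by simp
    then have "preserves (\<lambda>x y. x \<bullet> y = 0)" using c by simp
    \<comment> \<open>Orthogonality does not distinguish a vector from its negative, so only
      absolute values of inner products are available.\<close>
    then have "\<exists>R. bij_linear_isometry R \<and> (\<forall>x\<in>sphere 0 1. \<psi> x \<in> {- R x, R x})"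
      by (intro wigner_extension abs_inner_image)
    then show ?thesis using True by blast
  next
    case False
    have "c \<noteq> 0"
    proof
      assume "c = 0"
      then have "cos \<alpha> = cos (pi / 2)" by (simp add: c_def)
      then show False using cos_inj_pi[of \<alpha> "pi / 2"] \<alpha> False by simp
    qed
    moreover have "cos pi < c" "c < cos 0"
      unfolding c_def using \<alpha> by (intro cos_monotone_0_pi; simp)+
    then have "\<bar>c\<bar> < 1" by simp
    ultimately have "\<exists>R. bij_linear_isometry R \<and> (\<forall>x\<in>sphere 0 1. \<psi> x = R x)"
      using isometry_extension[OF inner_image_eq[OF c]] by blast
    then show ?thesis using False by blast
  qed
qed

end
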